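(* There exists a function $f:\mathbb{N}\to\mathbb{R}$ with $f(d)\in\mathcal{O}(d)$ such that for every $d\ge 2$ the following holds. Every simplicial $d$-cone $C=\mathbb{R}_+v_1+\cdots+\mathbb{R}_+v_d\subset\mathbb{R}^d$ which is not already unimodular (i.e., $\mu(C)>1$) has a unimodular triangulation $C=D_1\cup\ldots\cup D_t$ such that for all $i$ $$\operatorname{Hilb}(D_i)\subset \mu(C)^{f(d)}\,\Delta_C .$$
   Context: A simplicial $d$-cone $C=\mathbb{R}_+v_1+\cdots+\mathbb{R}_+v_d\subset\mathbb{R}^d$ is generated by linearly independent primitive vectors $v_1,\dots,v_d\in\mathbb{Z}^d$ (its extreme integral generators). Its multiplicity $\mu(C)$ is the index in $\mathbb{Z}^d$ of the sublattice spanned by $v_1,\dots,v_d$; $C$ is unimodular if $\mu(C)=1$. The basic simplex $\Delta_C$ is the convex hull of $0,v_1,\dots,v_d$, and $c\Delta_C=\{cy: y\in\Delta_C\}$ for $c\ge 0$. A triangulation $C=D_1\cup\ldots\cup D_t$ is a decomposition of $C$ into finitely many simplicial $d$-cones $D_i$ generated by vectors in $\mathbb{Z}^d$, any two of which intersect in a common face; it is unimodular if all $D_i$ are unimodular. $\operatorname{Hilb}(D)$ is the Hilbert basis of $D$, i.e. the unique minimal generating set of the monoid $D\cap\mathbb{Z}^d$ (for unimodular $D$ it is the set of the $d$ primitive generators of $D$). *)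

theory Defs
  imports
    "HOL-Analysis.Analysis"
    "HOL-Analysis.Finite_Function_Topology"
    "HOL-Computational_Algebra.Group_Closure"
    "HOL-Library.Landau_Symbols"
begin

text \<open>
  The dimension \<open>d\<close> is quantified inside the statement, so it cannot be carried by a type.
  All vectors live in the real vector space of finitely supported functions on the naturals,
  and the real \<open>d\<close>-space is the subspace of the functions supported on \<open>{..<d}\<close>.
\<close>

type_synonym rvec = "nat \<Rightarrow>\<^sub>0 real"

definition int_lattice :: "nat \<Rightarrow> rvec set" where
  "int_lattice d = {x. Poly_Mapping.keys x \<subseteq> {..<d} \<and> (\<forall>i. Poly_Mapping.lookup x i \<in> \<int>)}"

text \<open>The zero vector is not primitive, since it is twice itself.\<close>

definition primitive_vec :: "nat \<Rightarrow> rvec \<Rightarrow> bool" where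
  "primitive_vec d v \<longleftrightarrow>
     v \<in> int_lattice d \<and> (\<forall>w\<in>int_lattice d. \<forall>k::nat. v = real k *\<^sub>R w \<longrightarrow> k = 1)"

definition gen_cone :: "rvec set \<Rightarrow> rvec set" where
  "gen_cone V = {(\<Sum>v\<in>V. a v *\<^sub>R v) | a. \<forall>v\<in>V. 0 \<le> a v}"

text \<open>
  A simplicial \<open>d\<close>-cone is represented by the set of its extreme integral generators, which the
  cone determines.
\<close>

definition simplicial_gens :: "nat \<Rightarrow> rvec set \<Rightarrow> bool" where
  "simplicial_gens d V \<longleftrightarrow>
     finite V \<and> card V = d \<and> (\<forall>v\<in>V. primitive_vec d v) \<and> independent V"

definition simplicial_cone :: "nat \<Rightarrow> rvec set \<Rightarrow> bool" where
  "simplicial_cone d C \<longleftrightarrow> (\<exists>V. simplicial_gens d V \<and> C = gen_cone V)"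

text \<open>
  The index, as the number of cosets. For linearly independent \<open>V\<close> with \<open>d\<close> elements it is finite,
  so the convention that infinite sets have cardinality 0 plays no role.
\<close>

definition cone_mult :: "nat \<Rightarrow> rvec set \<Rightarrow> nat" where
  "cone_mult d V = card ((\<lambda>x. (+) x ` group_closure V) ` int_lattice d)"

definition unimodular_cone :: "nat \<Rightarrow> rvec set \<Rightarrow> bool" where
  "unimodular_cone d C \<longleftrightarrow> (\<exists>V. simplicial_gens d V \<and> C = gen_cone V \<and> cone_mult d V = 1)"

definition basic_simplex :: "rvec set \<Rightarrow> rvec set" where
  "basic_simplex V = convex hull (insert 0 V)"

definition cone_triangulation :: "nat \<Rightarrow> rvec set \<Rightarrow> rvec set set \<Rightarrow> bool" where
  "cone_triangulation d C T \<longleftrightarrow>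
     finite T \<and> (\<forall>D\<in>T. simplicial_cone d D) \<and> C = \<Union>T \<and>
     (\<forall>D\<in>T. \<forall>E\<in>T. D \<inter> E face_of D \<and> D \<inter> E face_of E)"

definition unimodular_triangulation :: "nat \<Rightarrow> rvec set \<Rightarrow> rvec set set \<Rightarrow> bool" where
  "unimodular_triangulation d C T \<longleftrightarrow>
     cone_triangulation d C T \<and> (\<forall>D\<in>T. unimodular_cone d D)"

inductive_set monoid_closure :: "rvec set \<Rightarrow> rvec set" for B where
  zero: "0 \<in> monoid_closure B"
| base: "b \<in> B \<Longrightarrow> b \<in> monoid_closure B"
| add: "x \<in> monoid_closure B \<Longrightarrow> y \<in> monoid_closure B \<Longrightarrow> x + y \<in> monoid_closure B"

definition minimal_generating_set :: "rvec set \<Rightarrow> rvec set \<Rightarrow> bool" where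
  "minimal_generating_set B M \<longleftrightarrow>
     monoid_closure B = M \<and> (\<forall>B'. B' \<subset> B \<longrightarrow> monoid_closure B' \<noteq> M)"

text \<open>
  For a simplicial cone the monoid of lattice points is finitely generated and has no units other
  than 0, so the minimal generating set exists and is unique (it consists of the irreducibles).
\<close>

definition Hilb :: "nat \<Rightarrow> rvec set \<Rightarrow> rvec set" where
  "Hilb d D = (THE B. minimal_generating_set B (D \<inter> int_lattice d))"

end

theory Submission
  imports Defs
begin

text \<open>
  Iterated stellar subdivision works with \<open>f d = 3 d\<close>. As long as some cone of the current
  triangulation has multiplicity greater than 1, choose a lattice vector \<open>x\<close> in it whose
  coordinates with respect to the generators lie between 0 and \<open>1 - 1 / (2 d)\<close> and do not all
  vanish. It exists because, among the multiples of a vector of prime order \<open>p\<close> modulo the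
  sublattice, at most \<open>p / (2 d)\<close> violate the upper bound in any one coordinate. Subdividing all
  cones that contain \<open>x\<close> replaces one generator by \<open>x\<close> in each part and multiplies the
  multiplicity by the corresponding coordinate.

  Let \<open>h\<close> be the linear form with value 1 on the given generators, and let \<open>S\<close> be the sum of
  \<open>h\<close> over the generators of a cone of multiplicity \<open>m\<close>. Since \<open>h x \<le> S\<close>, a step at most
  doubles \<open>S\<close>, while \<open>m ^ (2 d)\<close> is at least halved. Hence \<open>S * m ^ (2 d)\<close> never exceeds its
  initial value \<open>d * \<mu> ^ (2 d)\<close>, which is at most \<open>\<mu> ^ (3 d)\<close>.
\<close>

section \<open>Indices of sublattices\<close>

abbreviation cosets :: "'a::ab_group_add set \<Rightarrow> 'a set \<Rightarrow> 'a set set" where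
  "cosets A H \<equiv> (\<lambda>x. (+) x ` H) ` A"

lemma coset_eq_iff:
  fixes x y :: "'a::ab_group_add"
  shows "(+) x ` group_closure S = (+) y ` group_closure S \<longleftrightarrow> x - y \<in> group_closure S"
proof
  assume "(+) x ` group_closure S = (+) y ` group_closure S"
  moreover have "x \<in> (+) x ` group_closure S"
    using zero_in_group_closure by (force simp: image_iff)
  ultimately obtain s where "s \<in> group_closure S" "x = y + s"
    by auto
  then show "x - y \<in> group_closure S"
    by simp
next
  have sub: "(+) x ` group_closure S \<subseteq> (+) y ` group_closure S"
    if "x - y \<in> group_closure S" for x y :: 'a
  proof
    fix u assume "u \<in> (+) x ` group_closure S"
    then obtain s where "s \<in> group_closure S" "u = x + s"
      by auto
    then have "u = y + ((x - y) + s)" "(x - y) + s \<in> group_closure S"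
      using that by (auto intro: group_closure_add)
    then show "u \<in> (+) y ` group_closure S"
      by blast
  qed
  assume *: "x - y \<in> group_closure S"
  then have "y - x \<in> group_closure S"
    using group_closure_minus_iff[of "x - y" S] by simp
  with * show "(+) x ` group_closure S = (+) y ` group_closure S"
    using sub by blast
qed

lemma coset_representative:
  fixes L :: "'a::ab_group_add set"
  shows "\<exists>r. \<forall>c\<in>cosets L (group_closure S). r c \<in> L \<and> c = (+) (r c) ` group_closure S"
  by (intro bchoice) blast

lemma group_closure_mono_gen:
  fixes S T :: "'a::ab_group_add set"
  assumes "S \<subseteq> group_closure T"
  shows "group_closure S \<subseteq> group_closure T"
proof
  fix x assume "x \<in> group_closure S"
  then show "x \<in> group_closure T"
    by induction (use assms in \<open>auto intro: group_closure.diff\<close>)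
qed

lemma group_closure_scaleR_nat:
  fixes x :: "'a::real_vector"
  assumes "x \<in> group_closure S"
  shows "real n *\<^sub>R x \<in> group_closure S"
  by (induction n) (use assms in \<open>auto simp: scaleR_add_left intro: group_closure_add\<close>)

lemma group_closure_scaleR_Ints:
  fixes x :: "'a::real_vector"
  assumes "x \<in> group_closure S" "a \<in> \<int>"
  shows "a *\<^sub>R x \<in> group_closure S"
proof -
  obtain k where k: "a = of_int k"
    using assms(2) by (auto elim: Ints_cases)
  show ?thesis
  proof (cases k rule: int_cases2)
    case (nonneg n)
    then show ?thesis
      using group_closure_scaleR_nat[OF assms(1)] k by simp
  next
    case (nonpos n)
    then show ?thesis
      using group_closure_scaleR_nat[OF assms(1), of n] k by simp
  qed
qed

lemma group_closure_sum:
  fixes f :: "'b \<Rightarrow> 'a::ab_group_add"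
  assumes "\<And>i. i \<in> I \<Longrightarrow> f i \<in> group_closure S"
  shows "sum f I \<in> group_closure S"
  using assms by (induction I rule: infinite_finite_induct) (auto intro: group_closure_add)

lemma group_closure_lincomb:
  fixes W :: "'a::real_vector set"
  assumes "\<And>w. w \<in> A \<Longrightarrow> w \<in> group_closure W" "\<And>w. w \<in> A \<Longrightarrow> c w \<in> \<int>"
  shows "(\<Sum>w\<in>A. c w *\<^sub>R w) \<in> group_closure W"
  using assms by (intro group_closure_sum group_closure_scaleR_Ints) auto

text \<open>Every coset of \<open>group_closure N\<close> counted here is represented by some
  \<open>r c + i v\<close> with \<open>i < z\<close>, where \<open>r c\<close> is a fixed
  representative of a coset of \<open>group_closure M\<close>.\<close>

lemma card_cosets_refine_le:
  fixes L :: "'a::real_vector set"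
  assumes fin: "finite (cosets L (group_closure M))"
    and split: "\<And>y. y \<in> group_closure M \<Longrightarrow> \<exists>i<z. y - real i *\<^sub>R v \<in> group_closure N"
  shows "finite (cosets L (group_closure N))"
    and "card (cosets L (group_closure N)) \<le> z * card (cosets L (group_closure M))"
proof -
  obtain r where r: "\<forall>c\<in>cosets L (group_closure M). r c \<in> L \<and> c = (+) (r c) ` group_closure M"
    using coset_representative[of M L] by metis
  let ?f = "\<lambda>(c, i). (+) (r c + real i *\<^sub>R v) ` group_closure N"
  have sub: "cosets L (group_closure N) \<subseteq> ?f ` (cosets L (group_closure M) \<times> {..<z})"
  proof
    fix D assume "D \<in> cosets L (group_closure N)"
    then obtain x where x: "x \<in> L" "D = (+) x ` group_closure N"
      by auto
    let ?c = "(+) x ` group_closure M"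
    have c: "?c \<in> cosets L (group_closure M)"
      using x by auto
    have "?c = (+) (r ?c) ` group_closure M"
      using bspec[OF r c] by blast
    then have "x - r ?c \<in> group_closure M"
      unfolding coset_eq_iff .
    then obtain i where i: "i < z" "x - r ?c - real i *\<^sub>R v \<in> group_closure N"
      using split[of "x - r ?c"] by blast
    have "x - (r ?c + real i *\<^sub>R v) \<in> group_closure N"
      using i(2) by (simp only: diff_diff_eq)
    then have "D = ?f (?c, i)"
      unfolding x(2) prod.case coset_eq_iff .
    then show "D \<in> ?f ` (cosets L (group_closure M) \<times> {..<z})"
      by (rule image_eqI) (use c i(1) in simp)
  qed
  have finp: "finite (cosets L (group_closure M) \<times> {..<z})"
    using fin by simp
  show "finite (cosets L (group_closure N))"
    using finite_surj[OF finp sub] .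
  have "card (cosets L (group_closure N)) \<le> card (cosets L (group_closure M) \<times> {..<z})"
    using surj_card_le[OF finp sub] .
  then show "card (cosets L (group_closure N)) \<le> z * card (cosets L (group_closure M))"
    by (simp add: card_cartesian_product mult.commute)
qed

text \<open>The multiples \<open>i x\<close> with \<open>i < p\<close> lie in the larger group but
  are pairwise distinct modulo the smaller one, so every coset of the larger group contains at least
  \<open>p\<close> cosets of the smaller. Closure of \<open>L\<close> under the larger group keeps
  the shifted cosets among those counted.\<close>

lemma card_cosets_refine_ge:
  fixes L :: "'a::real_vector set"
  assumes fin: "finite (cosets L (group_closure N))"
    and NM: "group_closure N \<subseteq> group_closure M"
    and x: "x \<in> group_closure M" "\<And>i. 0 < i \<Longrightarrow> i < p \<Longrightarrow> real i *\<^sub>R x \<notin> group_closure N"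
    and L: "\<And>y u. y \<in> L \<Longrightarrow> u \<in> group_closure M \<Longrightarrow> y + u \<in> L"
  shows "finite (cosets L (group_closure M))"
    and "p * card (cosets L (group_closure M)) \<le> card (cosets L (group_closure N))"
proof -
  obtain r where r: "\<forall>c\<in>cosets L (group_closure N). r c \<in> L \<and> c = (+) (r c) ` group_closure N"
    using coset_representative[of N L] by metis
  have "cosets L (group_closure M) \<subseteq> (\<lambda>c. (+) (r c) ` group_closure M) ` cosets L (group_closure N)"
  proof
    fix D assume "D \<in> cosets L (group_closure M)"
    then obtain y where y: "y \<in> L" "D = (+) y ` group_closure M"
      by auto
    let ?c = "(+) y ` group_closure N"
    have c: "?c \<in> cosets L (group_closure N)"
      using y by auto
    have "?c = (+) (r ?c) ` group_closure N"
      using bspec[OF r c] by blast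
    then have "y - r ?c \<in> group_closure N"
      unfolding coset_eq_iff .
    then have "D = (+) (r ?c) ` group_closure M"
      unfolding y(2) coset_eq_iff by (rule subsetD[OF NM])
    then show "D \<in> (\<lambda>c. (+) (r c) ` group_closure M) ` cosets L (group_closure N)"
      using c by (rule image_eqI)
  qed
  then show "finite (cosets L (group_closure M))"
    by (rule finite_surj[OF fin])
  obtain s where s: "\<forall>c\<in>cosets L (group_closure M). s c \<in> L \<and> c = (+) (s c) ` group_closure M"
    using coset_representative[of M L] by metis
  let ?f = "\<lambda>(c, i). (+) (s c + real i *\<^sub>R x) ` group_closure N"
  have "inj_on ?f (cosets L (group_closure M) \<times> {..<p})"
  proof (rule inj_onI)
    fix a b
    assume ab: "a \<in> cosets L (group_closure M) \<times> {..<p}" "b \<in> cosets L (group_closure M) \<times> {..<p}"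
      and f_eq: "?f a = ?f b"
    obtain c i c' j where ab_eq: "a = (c, i)" "b = (c', j)"
      using prod.exhaust by metis
    have cc: "c \<in> cosets L (group_closure M)" "c' \<in> cosets L (group_closure M)" and ij: "i < p" "j < p"
      using ab unfolding ab_eq by (simp_all only: mem_Sigma_iff lessThan_iff)
    have e: "(s c + real i *\<^sub>R x) - (s c' + real j *\<^sub>R x) \<in> group_closure N"
      using f_eq unfolding ab_eq prod.case coset_eq_iff .
    have "s c - s c' = ((s c + real i *\<^sub>R x) - (s c' + real j *\<^sub>R x)) + (real j *\<^sub>R x - real i *\<^sub>R x)"
      by simp
    also have "\<dots> \<in> group_closure M"
      by (rule group_closure_add[OF subsetD[OF NM e] group_closure.diff]) (rule group_closure_scaleR_nat[OF x(1)])+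
    finally have "(+) (s c) ` group_closure M = (+) (s c') ` group_closure M"
      unfolding coset_eq_iff .
    then have eq: "c = c'"
      using bspec[OF s cc(1)] bspec[OF s cc(2)] by argo
    have d: "real i *\<^sub>R x - real j *\<^sub>R x \<in> group_closure N"
      using e eq by simp
    then have d': "real j *\<^sub>R x - real i *\<^sub>R x \<in> group_closure N"
      using group_closure_minus_iff[of "real i *\<^sub>R x - real j *\<^sub>R x" N] by simp
    have "i = j"
    proof (rule linorder_cases[of i j])
      assume "i < j"
      then have "real (j - i) *\<^sub>R x \<in> group_closure N"
        using d' by (simp add: of_nat_diff scaleR_diff_left)
      moreover have "0 < j - i" "j - i < p"
        using \<open>i < j\<close> ij by auto
      ultimately show ?thesis
        using x(2)[of "j - i"] by blast
    next
      assume "j < i"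
      then have "real (i - j) *\<^sub>R x \<in> group_closure N"
        using d by (simp add: of_nat_diff scaleR_diff_left)
      moreover have "0 < i - j" "i - j < p"
        using \<open>j < i\<close> ij by auto
      ultimately show ?thesis
        using x(2)[of "i - j"] by blast
    qed
    then show "a = b"
      using eq ab_eq by simp
  qed
  moreover have "?f ` (cosets L (group_closure M) \<times> {..<p}) \<subseteq> cosets L (group_closure N)"
  proof clarify
    fix y i assume "y \<in> L"
    then have "s ((+) y ` group_closure M) \<in> L"
      using bspec[OF s imageI[of y L]] by blast
    then have "s ((+) y ` group_closure M) + real i *\<^sub>R x \<in> L"
      using L group_closure_scaleR_nat[OF x(1)] by blast
    then show "(+) (s ((+) y ` group_closure M) + real i *\<^sub>R x) ` group_closure N \<in> cosets L (group_closure N)"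
      by (rule imageI)
  qed
  ultimately have "card (cosets L (group_closure M) \<times> {..<p}) \<le> card (cosets L (group_closure N))"
    using fin by (rule card_inj_on_le)
  then show "p * card (cosets L (group_closure M)) \<le> card (cosets L (group_closure N))"
    by (simp add: card_cartesian_product mult.commute)
qed

section \<open>Coordinates with respect to linearly independent vectors\<close>

lemma representation_lincomb:
  fixes W :: "'a::real_vector set"
  assumes "independent W" "finite W"
  shows "representation W (\<Sum>w\<in>W. c w *\<^sub>R w) w = (if w \<in> W then c w else 0)"
proof -
  have "representation W (\<Sum>w\<in>W. c w *\<^sub>R w) w = (\<Sum>u\<in>W. representation W (c u *\<^sub>R u) w)"
    using assms by (subst real_vector.representation_sum) (auto intro: span_base span_scale)
  also have "\<dots> = (\<Sum>u\<in>W. if u = w then c u else 0)"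
    using assms by (intro sum.cong refl)
      (auto simp: real_vector.representation_scale span_base real_vector.representation_basis)
  finally show ?thesis
    using assms by simp
qed

lemma lincomb_representation:
  fixes W :: "'a::real_vector set"
  assumes "independent W" "finite W" "y \<in> span W"
  shows "(\<Sum>w\<in>W. representation W y w *\<^sub>R w) = y"
  using real_vector.sum_representation_eq[of W y W] assms by auto

lemma lincomb_in_span: "(\<Sum>w\<in>W. c w *\<^sub>R w) \<in> span W" for W :: "'a::real_vector set"
  by (intro span_sum span_scale span_base)

lemma lincomb_eqD:
  fixes W :: "'a::real_vector set"
  assumes "independent W" "finite W" "(\<Sum>w\<in>W. c w *\<^sub>R w) = (\<Sum>w\<in>W. e w *\<^sub>R w)" "w \<in> W"
  shows "c w = e w"
  using representation_lincomb[OF assms(1,2), of c w] representation_lincomb[OF assms(1,2), of e w] assms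
  by simp

text \<open>Coordinates do not change when the basis is enlarged from \<open>W - {v}\<close> to
  \<open>W\<close>, so elements of the smaller span have \<open>v\<close>-coordinate 0, whereas here
  it is \<open>c v\<close>.\<close>

lemma lincomb_not_in_span_Diff:
  fixes W :: "'a::real_vector set"
  assumes W: "independent W" "finite W" and v: "v \<in> W" "c v \<noteq> 0"
  shows "(\<Sum>w\<in>W. c w *\<^sub>R w) \<notin> span (W - {v})"
proof
  assume "(\<Sum>w\<in>W. c w *\<^sub>R w) \<in> span (W - {v})"
  then have "representation W (\<Sum>w\<in>W. c w *\<^sub>R w) = representation (W - {v}) (\<Sum>w\<in>W. c w *\<^sub>R w)"
    using W by (intro real_vector.representation_extend) auto
  then have "representation W (\<Sum>w\<in>W. c w *\<^sub>R w) v = 0"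
    using real_vector.representation_ne_zero[of "W - {v}" _ v] by auto
  then show False
    using representation_lincomb[OF W, of c v] v by simp
qed

text \<open>Steinitz exchange of \<open>v\<close> for a vector with nonzero
  \<open>v\<close>-coordinate. That \<open>x\<close> is not among the remaining vectors keeps the
  cardinality unchanged.\<close>

lemma independent_exchange:
  fixes W :: "'a::real_vector set"
  assumes W: "independent W" "finite W" and v: "v \<in> W" "c v \<noteq> 0" and x: "x = (\<Sum>w\<in>W. c w *\<^sub>R w)"
  shows "x \<notin> W - {v}" "independent (insert x (W - {v}))"
proof -
  have notin: "x \<notin> span (W - {v})"
    unfolding x using lincomb_not_in_span_Diff[where c = c, OF W v] .
  then show "x \<notin> W - {v}"
    using span_base[of x "W - {v}"] by blast
  have "independent (W - {v})"
    using W(1) by (rule independent_mono) blast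
  with notin show "independent (insert x (W - {v}))"
    by (rule real_vector.independent_insertI)
qed

text \<open>Membership in the span is demanded separately because \<open>representation\<close> is
  constantly 0 outside the span, where integrality alone would hold as well.\<close>

lemma in_group_closure_iff:
  fixes W :: "'a::real_vector set"
  assumes "independent W" "finite W"
  shows "y \<in> group_closure W \<longleftrightarrow> y \<in> span W \<and> (\<forall>w. representation W y w \<in> \<int>)"
proof
  assume "y \<in> group_closure W"
  then show "y \<in> span W \<and> (\<forall>w. representation W y w \<in> \<int>)"
  proof induction
    case (base s)
    then show ?case
      using assms by (auto simp: span_zero real_vector.representation_zero span_base real_vector.representation_basis)
  next
    case (diff s t)
    then show ?case
      using assms by (auto simp: span_diff real_vector.representation_diff)
  qed
next
  assume "y \<in> span W \<and> (\<forall>w. representation W y w \<in> \<int>)"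
  then show "y \<in> group_closure W"
    using group_closure_lincomb[of W W "representation W y"] lincomb_representation[OF assms, of y]
    by (auto intro: group_closure.base)
qed

section \<open>Lattice vectors with small coordinates\<close>

text \<open>Scaling is defined through the abstraction function; the support of the scaled map lies
  in that of \<open>x\<close>, so the abstraction can be undone.\<close>

lemma lookup_scaleR [simp]:
  "Poly_Mapping.lookup (a *\<^sub>R x) i = a *\<^sub>R Poly_Mapping.lookup x i"
  for x :: "'b \<Rightarrow>\<^sub>0 'a::real_vector"
proof -
  have "finite {i. a *\<^sub>R Poly_Mapping.lookup x i \<noteq> 0}"
    by (rule finite_subset[OF _ finite_keys[of x]]) (auto simp: in_keys_iff)
  then show ?thesis
    by (simp add: scaleR_poly_mapping_def)
qed

lemma int_lattice_diff: "x \<in> int_lattice d \<Longrightarrow> y \<in> int_lattice d \<Longrightarrow> x - y \<in> int_lattice d"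
  unfolding int_lattice_def using keys_diff[of x y] by (auto simp: lookup_minus)

lemma int_lattice_zero [simp]: "0 \<in> int_lattice d"
  by (simp add: int_lattice_def)

lemma group_closure_int_lattice:
  assumes "W \<subseteq> int_lattice d"
  shows "group_closure W \<subseteq> int_lattice d"
proof
  fix x assume "x \<in> group_closure W"
  then show "x \<in> int_lattice d"
    by induction (use assms int_lattice_diff in auto)
qed

lemma int_lattice_eq_group_closure: "group_closure (int_lattice d) = int_lattice d"
  using group_closure_int_lattice[of "int_lattice d" d] by (auto intro: group_closure.base)

lemma int_lattice_add: "x \<in> int_lattice d \<Longrightarrow> y \<in> int_lattice d \<Longrightarrow> x + y \<in> int_lattice d"
  by (metis int_lattice_eq_group_closure group_closure_add)

lemma int_lattice_scaleR: "x \<in> int_lattice d \<Longrightarrow> a \<in> \<int> \<Longrightarrow> a *\<^sub>R x \<in> int_lattice d"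
  by (metis int_lattice_eq_group_closure group_closure_scaleR_Ints)

text \<open>
  Unlike \<^const>\<open>simplicial_gens\<close> this does not ask for primitive vectors. The vectors produced by
  the subdivision need not be primitive, but a basis of the lattice always is.
\<close>

definition sublattice_basis :: "nat \<Rightarrow> rvec set \<Rightarrow> bool" where
  "sublattice_basis d W \<longleftrightarrow> finite W \<and> card W = d \<and> W \<subseteq> int_lattice d \<and> independent W \<and>
     finite (cosets (int_lattice d) (group_closure W))"

section \<open>Sublattices of finite index and vectors of prime order\<close>

lemma cone_mult_pos: "sublattice_basis d W \<Longrightarrow> cone_mult d W > 0"
  unfolding sublattice_basis_def cone_mult_def card_gt_0_iff using int_lattice_zero by blast

text \<open>Pigeonhole: the multiples of \<open>y\<close> fall into finitely many cosets, and two
  that share one differ by a positive multiple of \<open>y\<close> in the sublattice.\<close>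

lemma sublattice_basis_torsion:
  assumes "sublattice_basis d W" "y \<in> int_lattice d"
  shows "\<exists>n>0. real n *\<^sub>R y \<in> group_closure W"
proof -
  let ?f = "\<lambda>n. (+) (real n *\<^sub>R y) ` group_closure W"
  have "real n *\<^sub>R y \<in> int_lattice d" for n
    using assms(2) by (intro int_lattice_scaleR) auto
  then have "range ?f \<subseteq> cosets (int_lattice d) (group_closure W)"
    by auto
  moreover have "finite (cosets (int_lattice d) (group_closure W))"
    using assms(1) unfolding sublattice_basis_def by blast
  ultimately have "finite (range ?f)"
    by (rule finite_subset)
  then have "\<not> inj ?f"
    using finite_imageD infinite_UNIV_nat by blast
  then obtain i j where "i < j" "?f i = ?f j"
    using linorder_injI[of ?f] by blast
  then have "real (j - i) *\<^sub>R y \<in> group_closure W"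
    using coset_eq_iff[of "real j *\<^sub>R y" W "real i *\<^sub>R y"] by (simp add: of_nat_diff scaleR_diff_left)
  then show ?thesis
    using \<open>i < j\<close> by (intro exI[of _ "j - i"]) auto
qed

text \<open>Unimodularity enters the arguments on primitivity and Hilbert bases in this form: the
  coset of 0 is the only one exactly when \<open>W\<close> is a lattice basis.\<close>

lemma cone_mult_eq_1_iff:
  assumes "sublattice_basis d W"
  shows "cone_mult d W = 1 \<longleftrightarrow> int_lattice d = group_closure W"
proof
  assume "cone_mult d W = 1"
  then obtain c where c: "cosets (int_lattice d) (group_closure W) = {c}"
    unfolding cone_mult_def by (rule card_1_singletonE)
  have "int_lattice d \<subseteq> group_closure W"
  proof
    fix y assume "y \<in> int_lattice d"
    then have "(+) y ` group_closure W \<in> {c}" "(+) 0 ` group_closure W \<in> {c}"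
      unfolding c[symmetric] by (intro imageI; simp)+
    then have "(+) y ` group_closure W = (+) 0 ` group_closure W"
      by (metis singletonD)
    then show "y \<in> group_closure W"
      unfolding coset_eq_iff by simp
  qed
  then show "int_lattice d = group_closure W"
    using assms group_closure_int_lattice unfolding sublattice_basis_def by blast
next
  assume eq: "int_lattice d = group_closure W"
  have "(+) y ` group_closure W = (+) 0 ` group_closure W" if "y \<in> group_closure W" for y
    unfolding coset_eq_iff using that by simp
  then have "cosets (group_closure W) (group_closure W) = {(+) 0 ` group_closure W}"
    using zero_in_group_closure[of W] by blast
  then show "cone_mult d W = 1"
    unfolding cone_mult_def eq by simp
qed

text \<open>Cauchy's theorem for the finite quotient group: if \<open>n\<close> is the order of a
  nontrivial class and \<open>p\<close> a prime divisor of \<open>n\<close>, the multiple by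
  \<open>n / p\<close> has order \<open>p\<close>.\<close>

lemma sublattice_basis_prime_order:
  assumes "sublattice_basis d W" "cone_mult d W > 1"
  obtains p y where "prime p" "y \<in> int_lattice d" "y \<notin> group_closure W" "real p *\<^sub>R y \<in> group_closure W"
proof -
  have "int_lattice d \<noteq> group_closure W"
    using cone_mult_eq_1_iff[OF assms(1)] assms(2) by simp
  moreover have "group_closure W \<subseteq> int_lattice d"
    using group_closure_int_lattice assms(1) unfolding sublattice_basis_def by blast
  ultimately obtain y where y: "y \<in> int_lattice d" "y \<notin> group_closure W"
    by blast
  define n where "n = (LEAST n. n > 0 \<and> real n *\<^sub>R y \<in> group_closure W)"
  have n: "n > 0" "real n *\<^sub>R y \<in> group_closure W"
    using LeastI_ex[OF sublattice_basis_torsion[OF assms(1) y(1)]] unfolding n_def by auto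
  have least: "real m *\<^sub>R y \<notin> group_closure W" if "0 < m" "m < n" for m
    using not_less_Least[of m] that unfolding n_def by blast
  have "n \<noteq> 1"
    using n y by auto
  then obtain p where p: "prime p" "p dvd n"
    using prime_factor_nat by blast
  then obtain m where m: "n = p * m"
    by blast
  have "0 < m" "m < n"
    using m n prime_gt_1_nat[OF p(1)] by auto
  then have "real m *\<^sub>R y \<notin> group_closure W" "real p *\<^sub>R (real m *\<^sub>R y) \<in> group_closure W"
    using least n(2) m by auto
  moreover have "real m *\<^sub>R y \<in> int_lattice d"
    using y(1) by (intro int_lattice_scaleR) auto
  ultimately show ?thesis
    using that p(1) by blast
qed

text \<open>
  As j runs through 1, ..., p - 1, each residue j z mod p is taken at most once, so fewer than
  p / (2 d) of the j are bad for a given z; for d values of z some j is good for all of them.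
\<close>

lemma exists_small_multiple:
  fixes z :: "'b \<Rightarrow> int"
  assumes p: "prime p" and W: "finite W"
  obtains j where "0 < j" "j < p"
    "\<And>w. w \<in> W \<Longrightarrow> 2 * int (card W) * ((int j * z w) mod int p) \<le> (2 * int (card W) - 1) * int p"
proof -
  define d where "d = card W"
  define bad where "bad w = {j\<in>{1..<p}. 2 * int d * ((int j * z w) mod int p) > (2 * int d - 1) * int p}" for w
  have p2: "p \<ge> 2"
    using prime_ge_2_nat[OF p] .
  have card_bad: "card (bad w) \<le> (p - 1) div (2 * d)" if "w \<in> W" for w
  proof (cases "int p dvd z w")
    case True
    have "d > 0"
      using that W d_def card_gt_0_iff by blast
    then have "(2 * int d - 1) * int p \<ge> 0"
      by (intro mult_nonneg_nonneg) auto
    then have "\<not> (2 * int d - 1) * int p < 0"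
      by (rule leD)
    moreover have "(int j * z w) mod int p = 0" for j
      using True by simp
    ultimately have "bad w = {}"
      unfolding bad_def by (simp only: mult_zero_right) blast
    then show ?thesis
      by simp
  next
    case False
    have d0: "d > 0"
      using that W d_def card_gt_0_iff by blast
    \<comment> \<open>\<open>?g j\<close> is the gap between the residue and \<open>p\<close>. A bad
      \<open>j\<close> has a gap between 1 and \<open>(p - 1) div (2 * d)\<close>, and distinct
      \<open>j\<close> have distinct gaps because \<open>z w\<close> is invertible modulo
      \<open>p\<close>.\<close>
    let ?g = "\<lambda>j. p - nat ((int j * z w) mod int p)"
    have mod_bounds: "0 \<le> (int j * z w) mod int p" "(int j * z w) mod int p < int p" for j
      using p2 by auto
    have "inj_on ?g {1..<p}"
    proof (rule inj_onI)
      fix i j assume ij: "i \<in> {1..<p}" "j \<in> {1..<p}" "?g i = ?g j"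
      then have "(int i * z w) mod int p = (int j * z w) mod int p"
        using mod_bounds[of i] mod_bounds[of j] by linarith
      then have "int p dvd (int i - int j) * z w"
        by (simp add: mod_eq_dvd_iff left_diff_distrib)
      then have "int p dvd int i - int j"
        using False p by (simp add: prime_dvd_mult_iff)
      then show "i = j"
        using ij zdvd_imp_le[of "int p" "int i - int j"] zdvd_imp_le[of "int p" "int j - int i"]
        by (cases i j rule: linorder_cases) (auto simp: dvd_diff_commute)
    qed
    moreover have "?g ` bad w \<subseteq> {1..(p - 1) div (2 * d)}"
    proof clarify
      fix j assume j: "j \<in> bad w"
      define r where "r = (int j * z w) mod int p"
      have r: "0 \<le> r" "r < int p" "2 * int d * r > (2 * int d - 1) * int p"
        using j mod_bounds[of j] by (auto simp: r_def bad_def)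
      then have "int (2 * d * (p - nat r)) < int p"
        by (simp add: of_nat_diff algebra_simps nat_le_iff)
      then have "2 * d * (p - nat r) \<le> p - 1"
        by linarith
      then have "p - nat r \<le> (p - 1) div (2 * d)"
        using d0 by (simp add: less_eq_div_iff_mult_less_eq mult.commute)
      then show "p - nat ((int j * z w) mod int p) \<in> {1..(p - 1) div (2 * d)}"
        using r by (auto simp: r_def)
    qed
    ultimately have "card (bad w) \<le> card {1..(p - 1) div (2 * d)}"
      by (intro card_inj_on_le[of ?g]) (auto simp: bad_def intro: inj_on_subset)
    then show ?thesis
      by simp
  qed
  have "card (\<Union>w\<in>W. bad w) \<le> (\<Sum>w\<in>W. card (bad w))"
    using W by (rule card_UN_le)
  also have "\<dots> \<le> d * ((p - 1) div (2 * d))"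
    using sum_mono[of W "\<lambda>w. card (bad w)" "\<lambda>_. (p - 1) div (2 * d)"] card_bad by (simp add: d_def)
  \<comment> \<open>The total is at most half of \<open>p - 1\<close>, and \<open>p - 1\<close> is
    positive; this leaves room for a good \<open>j\<close>.\<close>
  also have "\<dots> < p - 1"
  proof -
    have "2 * d * ((p - 1) div (2 * d)) \<le> p - 1"
      by simp
    then show ?thesis
      using p2 by linarith
  qed
  finally have "card (\<Union>w\<in>W. bad w) < card {1..<p}"
    by simp
  moreover have "finite (\<Union>w\<in>W. bad w)"
    using W by (auto simp: bad_def)
  ultimately have "\<not> {1..<p} \<subseteq> (\<Union>w\<in>W. bad w)"
    using card_mono by (metis not_less)
  then obtain j where "j \<in> {1..<p}" "j \<notin> (\<Union>w\<in>W. bad w)"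
    by blast
  then show ?thesis
    by (intro that[of j]) (force simp: bad_def d_def)+
qed

text \<open>The vector \<open>x\<close> has coordinates \<open>z w / p\<close>, kept as natural
  numerators over a common denominator. It arises from a vector \<open>y\<close> of prime order
  \<open>p\<close> modulo the sublattice by reducing the coordinates of a suitable multiple
  \<open>j y\<close> to their fractional parts.\<close>

lemma exists_subdivision_vector:
  assumes W: "sublattice_basis d W" "cone_mult d W > 1"
  shows "\<exists>p z x. p > 0 \<and> x \<in> int_lattice d \<and> real p *\<^sub>R x = (\<Sum>w\<in>W. real (z w) *\<^sub>R w) \<and>
    (\<forall>w\<in>W. 2 * d * z w \<le> (2 * d - 1) * p) \<and> (\<exists>w\<in>W. z w > 0)"
proof -
  obtain p y where y: "prime p" "y \<in> int_lattice d" "y \<notin> group_closure W" "real p *\<^sub>R y \<in> group_closure W"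
    using sublattice_basis_prime_order[OF W] by blast
  have fin: "finite W" "independent W" "card W = d" "W \<subseteq> int_lattice d"
    using W unfolding sublattice_basis_def by auto
  have p0: "p > 0"
    using prime_gt_0_nat[OF y(1)] .
  define c where "c w = \<lfloor>representation W (real p *\<^sub>R y) w\<rfloor>" for w
  have c: "representation W (real p *\<^sub>R y) w = of_int (c w)" for w
  proof -
    have "representation W (real p *\<^sub>R y) w \<in> \<int>"
      using y(4) in_group_closure_iff[OF fin(2,1)] by blast
    then show ?thesis
      by (simp add: c_def)
  qed
  have py: "real p *\<^sub>R y = (\<Sum>w\<in>W. of_int (c w) *\<^sub>R w)"
    using lincomb_representation[OF fin(2,1), of "real p *\<^sub>R y"] y(4)
    unfolding in_group_closure_iff[OF fin(2,1)] c by metis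
  obtain j where j: "0 < j" "j < p"
    "\<And>w. w \<in> W \<Longrightarrow> 2 * int d * ((int j * c w) mod int p) \<le> (2 * int d - 1) * int p"
    using exists_small_multiple[OF y(1) fin(1), of c] fin(3) by blast
  define z where "z w = nat ((int j * c w) mod int p)" for w
  define x where "x = real j *\<^sub>R y - (\<Sum>w\<in>W. of_int ((int j * c w) div int p) *\<^sub>R w)"
  have z: "int (z w) = (int j * c w) mod int p" for w
    using p0 by (simp add: z_def)
  have "(\<Sum>w\<in>W. of_int ((int j * c w) div int p) *\<^sub>R w) \<in> group_closure W"
    by (rule group_closure_lincomb) (auto intro: group_closure.base)
  then have xL: "x \<in> int_lattice d"
    unfolding x_def using group_closure_int_lattice[OF fin(4)] y(2)
    by (intro int_lattice_diff int_lattice_scaleR) auto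
  have "real p *\<^sub>R x = real j *\<^sub>R (real p *\<^sub>R y) - (\<Sum>w\<in>W. (real p * of_int ((int j * c w) div int p)) *\<^sub>R w)"
    by (simp add: x_def scaleR_diff_right scaleR_sum_right mult.commute)
  also have "\<dots> = (\<Sum>w\<in>W. (real j * of_int (c w) - real p * of_int ((int j * c w) div int p)) *\<^sub>R w)"
    by (simp add: py scaleR_sum_right sum_subtractf scaleR_diff_left)
  also have "\<dots> = (\<Sum>w\<in>W. real (z w) *\<^sub>R w)"
  proof (rule sum.cong[OF refl])
    fix w
    have "real j * of_int (c w) - real p * of_int ((int j * c w) div int p)
        = of_int (int j * c w - int p * ((int j * c w) div int p))"
      by simp
    also have "\<dots> = of_int (int (z w))"
      unfolding z by (simp add: minus_mult_div_eq_mod)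
    finally show "(real j * of_int (c w) - real p * of_int ((int j * c w) div int p)) *\<^sub>R w = real (z w) *\<^sub>R w"
      by simp
  qed
  finally have px: "real p *\<^sub>R x = (\<Sum>w\<in>W. real (z w) *\<^sub>R w)" .
  \<comment> \<open>If all residues vanished, \<open>p\<close> would divide every
    \<open>c w\<close>, since it does not divide \<open>j\<close>; dividing by \<open>p\<close>
    would put \<open>y\<close> into the sublattice.\<close>
  have "\<exists>w\<in>W. z w > 0"
  proof (rule ccontr)
    assume "\<not> (\<exists>w\<in>W. z w > 0)"
    then have "int p dvd int j * c w" if "w \<in> W" for w
      using that z[of w] by (auto simp: dvd_eq_mod_eq_0)
    moreover have "\<not> int p dvd int j"
      using j zdvd_imp_le[of "int p" "int j"] by auto
    ultimately have dv: "int p dvd c w" if "w \<in> W" for w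
      using that y(1) by (simp add: prime_dvd_mult_iff)
    have "real p *\<^sub>R y = real p *\<^sub>R (\<Sum>w\<in>W. of_int (c w div int p) *\<^sub>R w)"
      unfolding py scaleR_sum_right
    proof (rule sum.cong[OF refl])
      fix w assume "w \<in> W"
      then obtain k where k: "c w = int p * k"
        using dv by blast
      then show "of_int (c w) *\<^sub>R w = real p *\<^sub>R of_int (c w div int p) *\<^sub>R w"
        using p0 by simp
    qed
    then have "y = (\<Sum>w\<in>W. of_int (c w div int p) *\<^sub>R w)"
      using p0 by simp
    also have "\<dots> \<in> group_closure W"
      by (rule group_closure_lincomb) (auto intro: group_closure.base)
    finally show False
      using y(3) by blast
  qed
  \<comment> \<open>Positivity of \<open>d\<close> makes the truncated subtraction
    \<open>2 * d - 1\<close> agree with the integer one.\<close>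
  then have "d > 0"
    using fin card_gt_0_iff by blast
  have "2 * d * z w \<le> (2 * d - 1) * p" if "w \<in> W" for w
  proof -
    have "int (2 * d * z w) \<le> int ((2 * d - 1) * p)"
      using j(3)[OF that] \<open>d > 0\<close> by (simp add: z of_nat_diff)
    then show ?thesis
      by linarith
  qed
  then show ?thesis
    using p0 xL px \<open>\<exists>w\<in>W. z w > 0\<close> by blast
qed

text \<open>
  Both indices are compared through the common sublattice in which \<open>v\<close> is replaced by \<open>z v\<close>
  times \<open>v\<close>, equivalently \<open>x\<close> by \<open>p\<close> times \<open>x\<close>.
\<close>

lemma exchange_sublattice_basis:
  assumes W: "sublattice_basis d W" and v: "v \<in> W"
    and x: "x \<in> int_lattice d" "real p *\<^sub>R x = (\<Sum>w\<in>W. real (z w) *\<^sub>R w)"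
    and pos: "p > 0" "z v > 0"
  shows "sublattice_basis d (insert x (W - {v}))"
    and "p * cone_mult d (insert x (W - {v})) \<le> z v * cone_mult d W"
proof -
  have fin: "finite W" "independent W" "card W = d" "W \<subseteq> int_lattice d"
    using W unfolding sublattice_basis_def by auto
  let ?W' = "insert x (W - {v})"
  have xeq: "x = (\<Sum>w\<in>W. (real (z w) / real p) *\<^sub>R w)"
  proof -
    have "x = (1 / real p) *\<^sub>R (real p *\<^sub>R x)"
      using pos by simp
    then show ?thesis
      unfolding x(2) scaleR_sum_right by simp
  qed
  have repx: "representation W x v = real (z v) / real p"
    using representation_lincomb[OF fin(2,1), of "\<lambda>w. real (z w) / real p" v] v xeq by simp
  have x_span: "x \<in> span W"
    unfolding xeq by (rule lincomb_in_span)
  have "real (z v) / real p \<noteq> 0"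
    using pos by simp
  note indep = independent_exchange[where c = "\<lambda>w. real (z w) / real p", OF fin(2,1) v this xeq]
  have "Suc (card (W - {v})) = card W"
    using card_Suc_Diff1[OF fin(1) v] .
  then have card: "card ?W' = d"
    using indep(1) fin by simp
  let ?N = "insert (real (z v) *\<^sub>R v) (W - {v})"
  let ?L = "int_lattice d"
  \<comment> \<open>Divide the integral \<open>v\<close>-coordinate \<open>m\<close> by
    \<open>z v\<close> with remainder \<open>i\<close>; what is left after removing
    \<open>i v\<close> lies in the common sublattice.\<close>
  have split: "\<exists>i<z v. y - real i *\<^sub>R v \<in> group_closure ?N" if "y \<in> group_closure W" for y
  proof -
    let ?r = "representation W y"
    have y: "y \<in> span W" "\<forall>w. ?r w \<in> \<int>"
      using that in_group_closure_iff[OF fin(2,1)] by auto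
    then obtain m where m: "?r v = of_int m"
      using Ints_cases by metis
    define i where "i = nat (m mod int (z v))"
    have i: "i < z v" "int i = m mod int (z v)"
      using pos by (auto simp: i_def nat_less_iff)
    define S where "S = (\<Sum>w\<in>W - {v}. ?r w *\<^sub>R w)"
    have "y = (\<Sum>w\<in>W. ?r w *\<^sub>R w)"
      using lincomb_representation[OF fin(2,1) y(1)] by simp
    also have "\<dots> = ?r v *\<^sub>R v + S"
      using fin v by (simp add: S_def sum.remove)
    also have "?r v = of_int (m div int (z v)) * real (z v) + real i"
    proof -
      have "m = m div int (z v) * int (z v) + int i"
        unfolding i(2) by simp
      then have "real_of_int m = of_int (m div int (z v) * int (z v) + int i)"
        by presburger
      then show ?thesis
        unfolding m by simp
    qed
    finally have "y - real i *\<^sub>R v = of_int (m div int (z v)) *\<^sub>R (real (z v) *\<^sub>R v) + S"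
      by (simp add: scaleR_add_left)
    also have "\<dots> \<in> group_closure ?N"
    proof (rule group_closure_add)
      show "of_int (m div int (z v)) *\<^sub>R (real (z v) *\<^sub>R v) \<in> group_closure ?N"
        by (rule group_closure_scaleR_Ints) (auto intro: group_closure.base)
      show "S \<in> group_closure ?N"
        unfolding S_def using y by (intro group_closure_lincomb) (auto intro: group_closure.base)
    qed
    finally show ?thesis
      using i by blast
  qed
  have finW: "finite (cosets ?L (group_closure W))"
    using W unfolding sublattice_basis_def by blast
  note N = card_cosets_refine_le[where L = ?L and M = W and N = ?N and z = "z v" and v = v, OF finW split]
  have gc_base: "w \<in> group_closure ?W'" if "w \<in> ?W'" for w
    using that by (auto intro: group_closure.base)
  \<comment> \<open>Solving the relation for \<open>z v\<close> times \<open>v\<close> places the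
    common sublattice inside the one spanned by \<open>?W'\<close>.\<close>
  have "real (z v) *\<^sub>R v = real p *\<^sub>R x - (\<Sum>w\<in>W - {v}. real (z w) *\<^sub>R w)"
    using fin v by (simp add: x(2) sum.remove)
  also have "\<dots> \<in> group_closure ?W'"
    by (intro group_closure.diff group_closure_scaleR_nat group_closure_lincomb gc_base) auto
  finally have NW': "group_closure ?N \<subseteq> group_closure ?W'"
    by (intro group_closure_mono_gen) (auto intro: gc_base)
  \<comment> \<open>This divisibility keeps the multiples of \<open>x\<close> out of the common
    sublattice: \<open>i x\<close> has \<open>v\<close>-coordinate \<open>i z v / p\<close>, which
    is a multiple of \<open>z v\<close> only if \<open>p\<close> divides \<open>i\<close>.\<close>
  have mult_v: "y \<in> span W \<and> (\<exists>k. representation W y v = of_int k * real (z v))" if "y \<in> group_closure ?N" for y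
    using that
  proof induction
    case (base s)
    then consider "s = 0" | "s = real (z v) *\<^sub>R v" | "s \<in> W - {v}"
      by blast
    then show ?case
    proof cases
      case 1
      then show ?thesis
        by (auto simp: span_zero real_vector.representation_zero intro: exI[of _ 0])
    next
      case 2
      then show ?thesis
        using fin v by (auto simp: span_base span_scale real_vector.representation_scale
            real_vector.representation_basis intro: exI[of _ 1])
    next
      case 3
      then show ?thesis
        using fin v by (auto simp: span_base real_vector.representation_basis intro: exI[of _ 0])
    qed
  next
    case (diff s t)
    then obtain k l where "representation W s v = of_int k * real (z v)" "representation W t v = of_int l * real (z v)"
      by blast
    then show ?case
      using fin diff by (auto simp: span_diff real_vector.representation_diff left_diff_distrib
          intro: exI[of _ "k - l"])
  qed
  have order: "real i *\<^sub>R x \<notin> group_closure ?N" if "0 < i" "i < p" for i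
  proof
    assume "real i *\<^sub>R x \<in> group_closure ?N"
    then obtain k where "representation W (real i *\<^sub>R x) v = of_int k * real (z v)"
      using mult_v by blast
    then have "real i * (real (z v) / real p) = of_int k * real (z v)"
      using fin x_span repx by (simp add: real_vector.representation_scale)
    then have "real i = of_int k * real p"
      using pos by (simp add: field_simps)
    then have "int i = k * int p"
      by (metis of_int_eq_iff of_int_mult of_int_of_nat_eq)
    then have "int p dvd int i"
      by simp
    then show False
      using that zdvd_imp_le[of "int p" "int i"] by simp
  qed
  have W'L: "?W' \<subseteq> ?L"
    using fin x by auto
  have closed: "y + u \<in> ?L" if "y \<in> ?L" "u \<in> group_closure ?W'" for y u
    using that group_closure_int_lattice[OF W'L] int_lattice_add by blast
  note M = card_cosets_refine_ge[where L = ?L and M = ?W' and N = ?N and x = x and p = p,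
    OF N(1) NW' gc_base[OF insertI1] order closed]
  show "sublattice_basis d ?W'"
    unfolding sublattice_basis_def using M(1) card indep(2) W'L fin by auto
  show "p * cone_mult d ?W' \<le> z v * cone_mult d W"
    unfolding cone_mult_def using M(2) N(2) by auto
qed

section \<open>Cones and stellar subdivision\<close>

text \<open>Coefficients are normalized to be nonnegative everywhere and 0 outside \<open>W\<close>,
  so that those of different cones can be compared as functions.\<close>

lemma gen_cone_iff:
  "y \<in> gen_cone W \<longleftrightarrow>
     (\<exists>c. (\<forall>w. 0 \<le> c w) \<and> (\<forall>w. w \<notin> W \<longrightarrow> c w = 0) \<and> y = (\<Sum>w\<in>W. c w *\<^sub>R w))"
proof
  assume "y \<in> gen_cone W"
  then obtain a where a: "\<forall>v\<in>W. 0 \<le> a v" "y = (\<Sum>w\<in>W. a w *\<^sub>R w)"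
    unfolding gen_cone_def by blast
  let ?c = "\<lambda>w. if w \<in> W then a w else 0"
  have "y = (\<Sum>w\<in>W. ?c w *\<^sub>R w)"
    unfolding a(2) by (rule sum.cong) auto
  then show "\<exists>c. (\<forall>w. 0 \<le> c w) \<and> (\<forall>w. w \<notin> W \<longrightarrow> c w = 0) \<and> y = (\<Sum>w\<in>W. c w *\<^sub>R w)"
    using a(1) by (intro exI[of _ ?c]) auto
qed (auto simp: gen_cone_def)

lemma gen_coneI: "(\<And>w. w \<in> W \<Longrightarrow> 0 \<le> c w) \<Longrightarrow> (\<Sum>w\<in>W. c w *\<^sub>R w) \<in> gen_cone W"
  unfolding gen_cone_def by blast

lemma gen_cone_supportI:
  assumes "finite W" "A \<subseteq> W" "\<And>w. w \<in> A \<Longrightarrow> 0 \<le> c w" "\<And>w. w \<in> W - A \<Longrightarrow> c w = 0"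
  shows "(\<Sum>w\<in>W. c w *\<^sub>R w) \<in> gen_cone A"
proof -
  have "(\<Sum>w\<in>W. c w *\<^sub>R w) = (\<Sum>w\<in>A. c w *\<^sub>R w)"
    using assms by (intro sum.mono_neutral_right) auto
  then show ?thesis
    using gen_coneI[of A c] assms(3) by simp
qed

lemma gen_cone_mono:
  assumes "finite W" "A \<subseteq> W"
  shows "gen_cone A \<subseteq> gen_cone W"
proof
  fix y assume "y \<in> gen_cone A"
  then obtain c where c: "\<And>w. 0 \<le> c w" "\<And>w. w \<notin> A \<Longrightarrow> c w = 0" "y = (\<Sum>w\<in>A. c w *\<^sub>R w)"
    unfolding gen_cone_iff by blast
  have "y = (\<Sum>w\<in>W. c w *\<^sub>R w)"
    unfolding c(3) using assms c(2) by (intro sum.mono_neutral_left) auto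
  then show "y \<in> gen_cone W"
    using gen_coneI[of W c] c(1) by simp
qed

lemma gen_cone_base:
  assumes "finite W" "w \<in> W"
  shows "w \<in> gen_cone W"
proof -
  have "(\<Sum>u\<in>{w}. 1 *\<^sub>R u) \<in> gen_cone {w}"
    by (rule gen_coneI) simp
  then show ?thesis
    using gen_cone_mono[of W "{w}"] assms by auto
qed

lemma gen_cone_zero: "0 \<in> gen_cone W"
  using gen_coneI[of W "\<lambda>_. 0"] by simp

lemma gen_cone_add:
  assumes "x \<in> gen_cone W" "y \<in> gen_cone W"
  shows "x + y \<in> gen_cone W"
proof -
  obtain a where a: "\<And>w. 0 \<le> a w" "x = (\<Sum>w\<in>W. a w *\<^sub>R w)"
    using assms(1) unfolding gen_cone_iff by blast
  obtain b where b: "\<And>w. 0 \<le> b w" "y = (\<Sum>w\<in>W. b w *\<^sub>R w)"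
    using assms(2) unfolding gen_cone_iff by blast
  have "x + y = (\<Sum>w\<in>W. (a w + b w) *\<^sub>R w)"
    unfolding a(2) b(2) by (simp add: sum.distrib scaleR_add_left)
  then show ?thesis
    using gen_coneI[of W "\<lambda>w. a w + b w"] a(1) b(1) by simp
qed

lemma gen_cone_scaleR:
  assumes "x \<in> gen_cone W" "0 \<le> s"
  shows "s *\<^sub>R x \<in> gen_cone W"
proof -
  obtain a where a: "\<And>w. 0 \<le> a w" "x = (\<Sum>w\<in>W. a w *\<^sub>R w)"
    using assms(1) unfolding gen_cone_iff by blast
  have "s *\<^sub>R x = (\<Sum>w\<in>W. (s * a w) *\<^sub>R w)"
    unfolding a(2) by (simp add: scaleR_sum_right)
  then show ?thesis
    using gen_coneI[of W "\<lambda>w. s * a w"] a(1) assms(2) by simp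
qed

lemma convex_gen_cone: "convex (gen_cone W)"
  by (intro convexI gen_cone_add gen_cone_scaleR)

text \<open>The zero convention off \<open>W\<close> upgrades uniqueness on \<open>W\<close> to
  equality of functions, which lets coordinates taken in two different cones be identified.\<close>

lemma supported_coeffs_unique:
  fixes c e :: "'a::real_vector \<Rightarrow> real"
  assumes "independent W" "finite W" "(\<Sum>w\<in>W. c w *\<^sub>R w) = (\<Sum>w\<in>W. e w *\<^sub>R w)"
    "\<And>w. w \<notin> W \<Longrightarrow> c w = 0" "\<And>w. w \<notin> W \<Longrightarrow> e w = 0"
  shows "c = e"
proof
  fix w
  show "c w = e w"
    using lincomb_eqD[OF assms(1-3), of w] assms(4,5)[of w] by (cases "w \<in> W") auto
qed

text \<open>If an inner point of a segment has vanishing coordinates off \<open>A\<close>, so have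
  both endpoints: a combination of nonnegative numbers with positive weights is 0 only if both
  numbers are.\<close>

lemma gen_cone_face:
  assumes W: "independent W" "finite W" and A: "A \<subseteq> W"
  shows "gen_cone A face_of gen_cone W"
  unfolding face_of_def
proof (intro conjI ballI impI)
  show "gen_cone A \<subseteq> gen_cone W"
    using gen_cone_mono W A by blast
  show "convex (gen_cone A)"
    by (rule convex_gen_cone)
  fix a b x
  assume *: "a \<in> gen_cone W" "b \<in> gen_cone W" "x \<in> gen_cone A" "x \<in> open_segment a b"
  obtain u where u: "0 < u" "u < 1" "x = (1 - u) *\<^sub>R a + u *\<^sub>R b"
    using *(4) by (auto simp: in_segment)
  obtain f where f: "\<And>w. 0 \<le> f w" "a = (\<Sum>w\<in>W. f w *\<^sub>R w)"
    using *(1) unfolding gen_cone_iff by blast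
  obtain g where g: "\<And>w. 0 \<le> g w" "b = (\<Sum>w\<in>W. g w *\<^sub>R w)"
    using *(2) unfolding gen_cone_iff by blast
  obtain c where c: "\<And>w. w \<notin> A \<Longrightarrow> c w = 0" "x = (\<Sum>w\<in>A. c w *\<^sub>R w)"
    using *(3) unfolding gen_cone_iff by blast
  have "x = (\<Sum>w\<in>W. c w *\<^sub>R w)"
    unfolding c(2) using W A c(1) by (intro sum.mono_neutral_left) auto
  moreover have "x = (\<Sum>w\<in>W. ((1 - u) * f w + u * g w) *\<^sub>R w)"
    unfolding u(3) f(2) g(2) by (simp add: scaleR_sum_right sum.distrib scaleR_add_left)
  ultimately have eq: "c w = (1 - u) * f w + u * g w" if "w \<in> W" for w
    using lincomb_eqD[OF W, of c "\<lambda>w. (1 - u) * f w + u * g w" w] that by argo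
  have zero: "f w = 0 \<and> g w = 0" if "w \<in> W - A" for w
  proof -
    have "(1 - u) * f w + u * g w = 0"
      using eq[of w] c(1)[of w] that by simp
    moreover have "0 \<le> (1 - u) * f w" "0 \<le> u * g w"
      using u f(1) g(1) by simp_all
    ultimately have "(1 - u) * f w = 0" "u * g w = 0"
      by linarith+
    then show ?thesis
      using u by simp
  qed
  show "a \<in> gen_cone A"
    unfolding f(2) using W A f(1) zero by (intro gen_cone_supportI) auto
  show "b \<in> gen_cone A"
    unfolding g(2) using W A g(1) zero by (intro gen_cone_supportI) auto
qed

text \<open>The complex is a set of generating sets, so that common faces are spanned by common
  generators. One inclusion suffices, the other being monotonicity; \<open>gen_cone_face\<close>
  then yields the face relation.\<close>

definition cone_complex :: "rvec set set \<Rightarrow> bool" where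
  "cone_complex T \<longleftrightarrow> finite T \<and> (\<forall>W\<in>T. finite W \<and> independent W) \<and>
     (\<forall>A\<in>T. \<forall>B\<in>T. gen_cone A \<inter> gen_cone B \<subseteq> gen_cone (A \<inter> B))"

lemma cone_complex_Int:
  assumes "cone_complex T" "A \<in> T" "B \<in> T"
  shows "gen_cone A \<inter> gen_cone B = gen_cone (A \<inter> B)"
proof -
  have "gen_cone A \<inter> gen_cone B \<subseteq> gen_cone (A \<inter> B)" "finite A" "finite B"
    using assms unfolding cone_complex_def by auto
  then show ?thesis
    using gen_cone_mono[of A "A \<inter> B"] gen_cone_mono[of B "A \<inter> B"] by blast
qed

text \<open>\<open>F\<close> is meant to be the set of generators on which \<open>x\<close> has
  positive coordinates. Exchanging a generator outside \<open>F\<close> for \<open>x\<close> would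
  give a cone of lower dimension.\<close>

definition stellar_subdivision :: "rvec \<Rightarrow> rvec set \<Rightarrow> rvec set set \<Rightarrow> rvec set set" where
  "stellar_subdivision x F T =
     {W \<in> T. \<not> F \<subseteq> W} \<union> (\<lambda>(W, v). insert x (W - {v})) ` ({W \<in> T. F \<subseteq> W} \<times> F)"

text \<open>Extending \<open>a\<close> by 0 off \<open>F\<close> gives \<open>x\<close> the same
  coefficients in every cone whose generators include \<open>F\<close>; this makes the simultaneous
  subdivision of all these cones consistent.\<close>

locale positive_combination =
  fixes F :: "rvec set" and a :: "rvec \<Rightarrow> real" and x :: rvec
  assumes F_ne: "F \<noteq> {}"
    and a_pos: "\<And>w. w \<in> F \<Longrightarrow> a w > 0"
    and a_zero: "\<And>w. w \<notin> F \<Longrightarrow> a w = 0"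
    and x_eq: "x = (\<Sum>w\<in>F. a w *\<^sub>R w)"
begin

lemma a_nonneg: "0 \<le> a w"
  using a_pos[of w] a_zero[of w] by (cases "w \<in> F") auto

lemma x_eq_sum:
  assumes "finite W" "F \<subseteq> W"
  shows "x = (\<Sum>w\<in>W. a w *\<^sub>R w)"
  unfolding x_eq using assms a_zero by (intro sum.mono_neutral_left) auto

lemma exchange:
  assumes "independent W" "finite W" "F \<subseteq> W" "v \<in> F"
  shows "x \<notin> W - {v}" "independent (insert x (W - {v}))"
proof -
  have "v \<in> W" "a v \<noteq> 0"
    using assms a_pos[of v] by auto
  from independent_exchange[OF assms(1,2) this x_eq_sum[OF assms(2,3)]]
  show "x \<notin> W - {v}" "independent (insert x (W - {v}))" .
qed

text \<open>Two expansions share one coefficient function: the first, with weight \<open>t\<close>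
  on \<open>x\<close>, describes the part; the second, in the generators of \<open>W\<close>,
  permits comparison with other cones. The omission of \<open>v\<close> appears as
  \<open>c v = 0\<close>.\<close>

lemma gen_cone_exchange_coeffs:
  assumes W: "independent W" "finite W" "F \<subseteq> W" "v \<in> F" and y: "y \<in> gen_cone (insert x (W - {v}))"
  shows "\<exists>t c. 0 \<le> t \<and> (\<forall>w. 0 \<le> c w) \<and> c v = 0 \<and> (\<forall>w. w \<notin> W \<longrightarrow> c w = 0) \<and>
    y = t *\<^sub>R x + (\<Sum>w\<in>W. c w *\<^sub>R w) \<and> y = (\<Sum>w\<in>W. (t * a w + c w) *\<^sub>R w)"
proof -
  obtain b where b: "\<And>w. 0 \<le> b w" "y = (\<Sum>w\<in>insert x (W - {v}). b w *\<^sub>R w)"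
    using y unfolding gen_cone_iff by blast
  define c where "c w = (if w \<in> W - {v} then b w else 0)" for w
  have "y = b x *\<^sub>R x + (\<Sum>w\<in>W - {v}. b w *\<^sub>R w)"
    unfolding b(2) using W(2) exchange(1)[OF W] by (intro sum.insert) auto
  also have "(\<Sum>w\<in>W - {v}. b w *\<^sub>R w) = (\<Sum>w\<in>W. c w *\<^sub>R w)"
    using W(2) by (intro sum.mono_neutral_cong_left) (auto simp: c_def)
  finally have y_eq: "y = b x *\<^sub>R x + (\<Sum>w\<in>W. c w *\<^sub>R w)" .
  also have "b x *\<^sub>R x = (\<Sum>w\<in>W. (b x * a w) *\<^sub>R w)"
    by (subst x_eq_sum[OF W(2,3)]) (simp add: scaleR_sum_right)
  also have "(\<Sum>w\<in>W. (b x * a w) *\<^sub>R w) + (\<Sum>w\<in>W. c w *\<^sub>R w) = (\<Sum>w\<in>W. (b x * a w + c w) *\<^sub>R w)"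
    by (simp add: sum.distrib scaleR_add_left)
  finally show ?thesis
    using b(1) y_eq by (intro exI[of _ "b x"] exI[of _ c]) (auto simp: c_def)
qed

text \<open>A converse to the expansion above, for an arbitrary subset \<open>A\<close> of
  \<open>W\<close> so that it also serves for the intersection of two parts.\<close>

lemma gen_cone_exchangeI:
  assumes "finite A" "x \<notin> A" "0 \<le> t" "\<And>w. w \<in> A \<Longrightarrow> 0 \<le> c w" "finite W" "A \<subseteq> W" "\<And>w. w \<in> W - A \<Longrightarrow> c w = 0"
  shows "t *\<^sub>R x + (\<Sum>w\<in>W. c w *\<^sub>R w) \<in> gen_cone (insert x A)"
proof -
  define b where "b w = (if w = x then t else c w)" for w
  have "(\<Sum>w\<in>insert x A. b w *\<^sub>R w) = b x *\<^sub>R x + (\<Sum>w\<in>A. b w *\<^sub>R w)"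
    using assms by (intro sum.insert) auto
  also have "(\<Sum>w\<in>A. b w *\<^sub>R w) = (\<Sum>w\<in>W. c w *\<^sub>R w)"
    using assms by (intro sum.mono_neutral_cong_left) (auto simp: b_def)
  also have "b x = t"
    by (simp add: b_def)
  finally have "t *\<^sub>R x + (\<Sum>w\<in>W. c w *\<^sub>R w) = (\<Sum>w\<in>insert x A. b w *\<^sub>R w)"
    by simp
  also have "\<dots> \<in> gen_cone (insert x A)"
    using assms(3,4) by (intro gen_coneI) (auto simp: b_def)
  finally show ?thesis .
qed

lemma gen_cone_exchange_subset:
  assumes W: "independent W" "finite W" "F \<subseteq> W" "v \<in> F"
  shows "gen_cone (insert x (W - {v})) \<subseteq> gen_cone W"
proof
  fix y assume "y \<in> gen_cone (insert x (W - {v}))"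
  then obtain t c where *: "0 \<le> t" "\<And>w. 0 \<le> c w" "y = (\<Sum>w\<in>W. (t * a w + c w) *\<^sub>R w)"
    using gen_cone_exchange_coeffs[OF W, of y] by blast
  show "y \<in> gen_cone W"
    unfolding *(3) using *(1,2) a_nonneg by (intro gen_coneI) auto
qed

text \<open>
  A point with coordinates \<open>c\<close> lies in the part that omits a vector of \<open>F\<close> minimizing
  \<open>c w / a w\<close>.
\<close>

lemma gen_cone_subset_exchange:
  assumes W: "independent W" "finite W" "F \<subseteq> W"
  shows "gen_cone W \<subseteq> (\<Union>v\<in>F. gen_cone (insert x (W - {v})))"
proof
  fix y assume "y \<in> gen_cone W"
  then obtain c where c: "\<And>w. 0 \<le> c w" "y = (\<Sum>w\<in>W. c w *\<^sub>R w)"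
    unfolding gen_cone_iff by blast
  have finF: "finite F"
    using W finite_subset by blast
  obtain v where v: "v \<in> F" "\<And>w. w \<in> F \<Longrightarrow> c v / a v \<le> c w / a w"
    using ex_min_if_finite[of "(\<lambda>w. c w / a w) ` F"] finF F_ne by (force simp: not_less)
  define t where "t = c v / a v"
  define e where "e w = c w - t * a w" for w
  have t: "0 \<le> t"
    using c(1)[of v] a_nonneg[of v] by (simp add: t_def)
  have e: "0 \<le> e w" for w
  proof (cases "w \<in> F")
    case True
    then show ?thesis
      using v(2)[OF True] a_pos[OF True] by (simp add: e_def t_def field_simps)
  next
    case False
    then show ?thesis
      using c(1)[of w] a_zero[of w] by (simp add: e_def)
  qed
  have ev: "e v = 0"
    using a_pos[OF v(1)] by (simp add: e_def t_def)
  have "y = (\<Sum>w\<in>W. (t * a w) *\<^sub>R w) + (\<Sum>w\<in>W. e w *\<^sub>R w)"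
    unfolding c(2) sum.distrib[symmetric] scaleR_add_left[symmetric] by (simp add: e_def)
  also have "(\<Sum>w\<in>W. (t * a w) *\<^sub>R w) = t *\<^sub>R x"
    by (subst x_eq_sum[OF W(2,3)]) (simp add: scaleR_sum_right)
  also have "t *\<^sub>R x + (\<Sum>w\<in>W. e w *\<^sub>R w) \<in> gen_cone (insert x (W - {v}))"
    using W(2) exchange(1)[OF W v(1)] t e ev by (intro gen_cone_exchangeI) auto
  finally show "y \<in> (\<Union>v\<in>F. gen_cone (insert x (W - {v})))"
    using v(1) by blast
qed

text \<open>Some \<open>u\<close> in \<open>F\<close> is missing from \<open>B\<close>, so a common
  point has \<open>u\<close>-coordinate 0. This coordinate is at least \<open>t a u\<close> with
  \<open>a u\<close> positive, hence \<open>t = 0\<close> and \<open>x\<close> does not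
  occur.\<close>

lemma exchange_Int_old:
  assumes W: "independent W" "finite W" "F \<subseteq> W" "v \<in> F"
    and B: "\<not> F \<subseteq> B" "gen_cone W \<inter> gen_cone B \<subseteq> gen_cone (W \<inter> B)" "finite B"
  shows "gen_cone (insert x (W - {v})) \<inter> gen_cone B \<subseteq> gen_cone (insert x (W - {v}) \<inter> B)"
proof
  fix y assume y: "y \<in> gen_cone (insert x (W - {v})) \<inter> gen_cone B"
  then obtain t c where c: "0 \<le> t" "\<And>w. 0 \<le> c w" "c v = 0" "\<And>w. w \<notin> W \<Longrightarrow> c w = 0"
    "y = t *\<^sub>R x + (\<Sum>w\<in>W. c w *\<^sub>R w)" "y = (\<Sum>w\<in>W. (t * a w + c w) *\<^sub>R w)"
    using gen_cone_exchange_coeffs[OF W, of y] by blast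
  have "y \<in> gen_cone (W \<inter> B)"
    using y B(2) gen_cone_exchange_subset[OF W] by blast
  then obtain e where e: "\<And>w. w \<notin> W \<inter> B \<Longrightarrow> e w = 0" "y = (\<Sum>w\<in>W \<inter> B. e w *\<^sub>R w)"
    unfolding gen_cone_iff by blast
  have "y = (\<Sum>w\<in>W. e w *\<^sub>R w)"
    unfolding e(2) using W(2) e(1) by (intro sum.mono_neutral_left) auto
  then have eq: "t * a w + c w = e w" if "w \<in> W" for w
    using lincomb_eqD[OF W(1,2), of "\<lambda>w. t * a w + c w" e w] c(6) that by argo
  obtain u where u: "u \<in> F" "u \<notin> B"
    using B(1) by blast
  have "t * a u + c u = 0"
    using eq[of u] e(1)[of u] u W(3) by auto
  moreover have "0 \<le> t * a u"
    using c(1) a_nonneg by simp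
  ultimately have "t * a u = 0"
    using c(2)[of u] by linarith
  then have t: "t = 0"
    using a_pos[OF u(1)] by simp
  have "c w = 0" if "w \<in> W - (W - {v}) \<inter> B" for w
    using that eq[of w] e(1)[of w] t c(3) by auto
  then have "y \<in> gen_cone ((W - {v}) \<inter> B)"
    unfolding c(5) t using W(2) c(2) by (simp, intro gen_cone_supportI) auto
  moreover have "gen_cone ((W - {v}) \<inter> B) \<subseteq> gen_cone (insert x (W - {v}) \<inter> B)"
    using B(3) by (intro gen_cone_mono) auto
  ultimately show "y \<in> gen_cone (insert x (W - {v}) \<inter> B)"
    by blast
qed

text \<open>The point determines the weight of \<open>x\<close>: its \<open>v\<close>-coordinate is
  \<open>t a v\<close> in the first expansion and at least \<open>s a v\<close> in the second, and
  symmetrically at \<open>u\<close>. So the weights agree, then the remaining coefficients do, and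
  only generators common to both parts occur.\<close>

lemma exchange_Int_exchange:
  assumes W: "independent W" "finite W" "F \<subseteq> W" "v \<in> F"
    and B: "independent B" "finite B" "F \<subseteq> B" "u \<in> F"
    and WB: "gen_cone W \<inter> gen_cone B \<subseteq> gen_cone (W \<inter> B)"
  shows "gen_cone (insert x (W - {v})) \<inter> gen_cone (insert x (B - {u}))
    \<subseteq> gen_cone (insert x (W - {v}) \<inter> insert x (B - {u}))"
proof
  fix y assume y: "y \<in> gen_cone (insert x (W - {v})) \<inter> gen_cone (insert x (B - {u}))"
  then obtain t c where c: "0 \<le> t" "\<And>w. 0 \<le> c w" "c v = 0" "\<And>w. w \<notin> W \<Longrightarrow> c w = 0"
    "y = t *\<^sub>R x + (\<Sum>w\<in>W. c w *\<^sub>R w)" "y = (\<Sum>w\<in>W. (t * a w + c w) *\<^sub>R w)"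
    using gen_cone_exchange_coeffs[OF W, of y] by blast
  obtain s b where b: "0 \<le> s" "\<And>w. 0 \<le> b w" "b u = 0" "\<And>w. w \<notin> B \<Longrightarrow> b w = 0"
    "y = (\<Sum>w\<in>B. (s * a w + b w) *\<^sub>R w)"
    using y gen_cone_exchange_coeffs[OF B, of y] by blast
  have "y \<in> gen_cone (W \<inter> B)"
    using y WB gen_cone_exchange_subset[OF W] gen_cone_exchange_subset[OF B] by blast
  then obtain e where e: "\<And>w. w \<notin> W \<inter> B \<Longrightarrow> e w = 0" "y = (\<Sum>w\<in>W \<inter> B. e w *\<^sub>R w)"
    unfolding gen_cone_iff by blast
  have eW: "y = (\<Sum>w\<in>W. e w *\<^sub>R w)"
    unfolding e(2) using W(2) e(1) by (intro sum.mono_neutral_left) auto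
  have eB: "y = (\<Sum>w\<in>B. e w *\<^sub>R w)"
    unfolding e(2) using B(2) e(1) by (intro sum.mono_neutral_left) auto
  have eq1: "(\<lambda>w. t * a w + c w) = e"
  proof (rule supported_coeffs_unique[OF W(1,2)])
    show "(\<Sum>w\<in>W. (t * a w + c w) *\<^sub>R w) = (\<Sum>w\<in>W. e w *\<^sub>R w)"
      using c(6) eW by argo
    show "t * a w + c w = 0" if "w \<notin> W" for w
      using that c(4) a_zero W(3) by auto
    show "e w = 0" if "w \<notin> W" for w
      using that e(1) by auto
  qed
  have eq2: "(\<lambda>w. s * a w + b w) = e"
  proof (rule supported_coeffs_unique[OF B(1,2)])
    show "(\<Sum>w\<in>B. (s * a w + b w) *\<^sub>R w) = (\<Sum>w\<in>B. e w *\<^sub>R w)"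
      using b(5) eB by argo
    show "s * a w + b w = 0" if "w \<notin> B" for w
      using that b(4) a_zero B(3) by auto
    show "e w = 0" if "w \<notin> B" for w
      using that e(1) by auto
  qed
  have eq: "t * a w + c w = s * a w + b w" for w
    using fun_cong[OF eq1, of w] fun_cong[OF eq2, of w] by simp
  have "s * a v \<le> t * a v" "t * a u \<le> s * a u"
    using eq[of v] eq[of u] c(2)[of u] c(3) b(2)[of v] b(3) by linarith+
  then have ts: "t = s"
    using a_pos[OF W(4)] a_pos[OF B(4)] by simp
  then have cb: "c w = b w" for w
    using eq[of w] by simp
  let ?A = "(W - {v}) \<inter> (B - {u})"
  have zero: "c w = 0" if "w \<in> W - ?A" for w
    using that c(3) b(3) b(4)[of w] cb by (cases "w \<in> B") auto
  have "y \<in> gen_cone (insert x ?A)"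
    unfolding c(5) using W(2) exchange(1)[OF W] c(1,2) zero by (intro gen_cone_exchangeI) auto
  then show "y \<in> gen_cone (insert x (W - {v}) \<inter> insert x (B - {u}))"
    by (simp add: Int_insert_left Int_insert_right insert_absorb cong: if_cong)
qed

lemma stellar_subdivision_cases:
  assumes "A \<in> stellar_subdivision x F T"
  obtains (old) "A \<in> T" "\<not> F \<subseteq> A"
    | (new) W v where "W \<in> T" "F \<subseteq> W" "v \<in> F" "A = insert x (W - {v})"
  using assms unfolding stellar_subdivision_def by blast

lemma cone_complex_stellar_subdivision:
  assumes T: "cone_complex T" and finF: "finite F"
  shows "cone_complex (stellar_subdivision x F T)"
proof -
  have TD: "finite W" "independent W" if "W \<in> T" for W
    using T that unfolding cone_complex_def by auto
  have TI: "gen_cone A \<inter> gen_cone B \<subseteq> gen_cone (A \<inter> B)" if "A \<in> T" "B \<in> T" for A B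
    using T that unfolding cone_complex_def by blast
  have 1: "finite (stellar_subdivision x F T)"
    using T finF unfolding cone_complex_def stellar_subdivision_def by simp
  have 2: "finite A \<and> independent A" if "A \<in> stellar_subdivision x F T" for A
    using that
  proof (cases rule: stellar_subdivision_cases)
    case old
    then show ?thesis
      using TD by blast
  next
    case (new W v)
    then show ?thesis
      using exchange(2)[OF TD(2) TD(1)] TD(1) by simp
  qed
  have 3: "gen_cone A \<inter> gen_cone B \<subseteq> gen_cone (A \<inter> B)"
    if A: "A \<in> stellar_subdivision x F T" and B: "B \<in> stellar_subdivision x F T" for A B
    using A
  proof (cases rule: stellar_subdivision_cases)
    case oldA: old
    show ?thesis
      using B
    proof (cases rule: stellar_subdivision_cases)
      case old
      then show ?thesis
        using oldA TI by blast
    next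
      case (new W v)
      then show ?thesis
        using exchange_Int_old[OF TD(2) TD(1), of W v A] oldA TI[of W A] TD(1)[of A]
        by (simp add: Int_commute)
    qed
  next
    case newA: (new W v)
    show ?thesis
      using B
    proof (cases rule: stellar_subdivision_cases)
      case old
      then show ?thesis
        using exchange_Int_old[OF TD(2) TD(1), of W v B] newA TI[of W B] TD(1)[of B] by simp
    next
      case (new W' v')
      show ?thesis
        unfolding newA(4) new(4)
        using newA new TD TI[of W W'] by (intro exchange_Int_exchange) auto
    qed
  qed
  show ?thesis
    unfolding cone_complex_def using 1 2 3 by blast
qed

lemma Union_stellar_subdivision:
  assumes T: "cone_complex T"
  shows "\<Union> (gen_cone ` stellar_subdivision x F T) = \<Union> (gen_cone ` T)"
proof (intro equalityI subsetI)
  have TD: "independent W" "finite W" if "W \<in> T" for W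
    using T that unfolding cone_complex_def by auto
  {
    fix y assume "y \<in> \<Union> (gen_cone ` stellar_subdivision x F T)"
    then obtain A where A: "A \<in> stellar_subdivision x F T" "y \<in> gen_cone A"
      by blast
    from A(1) show "y \<in> \<Union> (gen_cone ` T)"
    proof (cases rule: stellar_subdivision_cases)
      case old
      then show ?thesis
        using A(2) by blast
    next
      case (new W v)
      then show ?thesis
        using A(2) gen_cone_exchange_subset[OF TD[OF new(1)] new(2,3)] by blast
    qed
  next
    fix y assume "y \<in> \<Union> (gen_cone ` T)"
    then obtain W where W: "W \<in> T" "y \<in> gen_cone W"
      by blast
    show "y \<in> \<Union> (gen_cone ` stellar_subdivision x F T)"
    proof (cases "F \<subseteq> W")
      case True
      then obtain v where v: "v \<in> F" "y \<in> gen_cone (insert x (W - {v}))"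
        using gen_cone_subset_exchange[OF TD[OF W(1)]] W(2) by blast
      then have "insert x (W - {v}) \<in> stellar_subdivision x F T"
        unfolding stellar_subdivision_def using True W(1) by force
      then show ?thesis
        using v(2) by blast
    next
      case False
      then show ?thesis
        using W unfolding stellar_subdivision_def by blast
    qed
  }
qed

end

section \<open>Hilbert bases of unimodular cones\<close>

lemma representation_nonneg_gen_cone:
  assumes "independent W" "finite W" "y \<in> gen_cone W"
  shows "y \<in> span W" "0 \<le> representation W y w"
proof -
  obtain c where c: "\<And>w. 0 \<le> c w" "y = (\<Sum>w\<in>W. c w *\<^sub>R w)"
    using assms(3) unfolding gen_cone_iff by blast
  show "y \<in> span W"
    unfolding c(2) by (rule lincomb_in_span)
  show "0 \<le> representation W y w"
    unfolding c(2) representation_lincomb[OF assms(1,2)] using c(1) by simp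
qed

text \<open>For a lattice basis, the lattice points of the cone have coordinates that are both
  nonnegative and integral, that is, natural numbers.\<close>

lemma lattice_basis_monoid_closure:
  assumes W: "independent W" "finite W" and L: "int_lattice d = group_closure W"
  shows "monoid_closure W = gen_cone W \<inter> int_lattice d"
proof (intro equalityI subsetI)
  fix y assume "y \<in> monoid_closure W"
  then show "y \<in> gen_cone W \<inter> int_lattice d"
  proof induction
    case zero
    show ?case
      using gen_cone_zero by simp
  next
    case (base b)
    then show ?case
      using gen_cone_base[OF W(2)] L by (auto intro: group_closure.base)
  next
    case (add x y)
    then show ?case
      using gen_cone_add int_lattice_add by simp
  qed
next
  fix y assume y: "y \<in> gen_cone W \<inter> int_lattice d"
  let ?r = "representation W y"
  have r: "y \<in> span W" "\<And>w. 0 \<le> ?r w" "\<And>w. ?r w \<in> \<int>"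
    using representation_nonneg_gen_cone[OF W, of y] y in_group_closure_iff[OF W, of y] L by auto
  have scale: "real n *\<^sub>R w \<in> monoid_closure W" if "w \<in> W" for n w
    by (induction n) (use that in \<open>auto simp: scaleR_add_left intro: monoid_closure.intros\<close>)
  have part: "?r w *\<^sub>R w \<in> monoid_closure W" if "w \<in> W" for w
  proof -
    have "?r w \<in> \<nat>"
      using r(2)[of w] r(3)[of w] by (simp add: Nats_altdef2)
    then show ?thesis
      using scale[OF that] by (auto elim: Nats_cases)
  qed
  have "(\<Sum>w\<in>A. ?r w *\<^sub>R w) \<in> monoid_closure W" if "finite A" "A \<subseteq> W" for A
    using that by (induction A) (auto intro: monoid_closure.intros part)
  then show "y \<in> monoid_closure W"
    using W(2) lincomb_representation[OF W r(1)] by force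
qed

text \<open>A basis vector has coordinate sum 1, so it is not a sum of two nonzero lattice points of the cone.\<close>

lemma lattice_basis_irreducible:
  assumes W: "independent W" "finite W" and L: "int_lattice d = group_closure W" and w: "w \<in> W"
    and x: "x \<in> gen_cone W \<inter> int_lattice d" and y: "y \<in> gen_cone W \<inter> int_lattice d"
    and sum: "x + y = w"
  shows "x = 0 \<or> y = 0"
proof -
  let ?R = "\<lambda>u. \<Sum>v\<in>W. representation W u v"
  have x': "x \<in> span W" "\<And>v. 0 \<le> representation W x v" "\<And>v. representation W x v \<in> \<int>"
    using representation_nonneg_gen_cone[OF W, of x] x in_group_closure_iff[OF W, of x] L by auto
  have y': "y \<in> span W" "\<And>v. 0 \<le> representation W y v" "\<And>v. representation W y v \<in> \<int>"
    using representation_nonneg_gen_cone[OF W, of y] y in_group_closure_iff[OF W, of y] L by auto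
  have "?R x + ?R y = ?R w"
    unfolding sum[symmetric] using W x'(1) y'(1) by (simp add: real_vector.representation_add sum.distrib)
  also have "\<dots> = 1"
    using W w by (simp add: real_vector.representation_basis)
  finally have eq: "?R x + ?R y = 1" .
  have "?R x \<in> \<nat>" "?R y \<in> \<nat>"
    using x' y' by (auto simp: Nats_altdef2 intro!: sum_nonneg Ints_sum)
  then obtain m n where "?R x = real m" "?R y = real n"
    by (metis Nats_cases)
  moreover from this have "m + n = 1"
    using eq by (metis of_nat_1 of_nat_add of_nat_eq_iff)
  ultimately have "?R x = 0 \<or> ?R y = 0"
    by (auto simp: add_is_1)
  moreover have "u = 0" if "?R u = 0" "u \<in> span W" "\<And>v. 0 \<le> representation W u v" for u
  proof -
    have "\<forall>v\<in>W. representation W u v = 0"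
      using that(1,3) W(2) by (simp add: sum_nonneg_eq_0_iff)
    then show ?thesis
      using lincomb_representation[OF W that(2)] by simp
  qed
  ultimately show ?thesis
    using x' y' by blast
qed

text \<open>Induction over how a basis vector is generated: irreducibility collapses each sum to one
  summand, until an element of \<open>B\<close> is reached.\<close>

lemma lattice_basis_subset_generators:
  assumes W: "independent W" "finite W" and L: "int_lattice d = group_closure W"
    and B: "monoid_closure B = gen_cone W \<inter> int_lattice d"
  shows "W \<subseteq> B"
proof
  fix w assume w: "w \<in> W"
  then have "w \<in> gen_cone W \<inter> int_lattice d"
    using gen_cone_base[OF W(2)] L by (auto intro: group_closure.base)
  then have "w \<in> monoid_closure B"
    using B by simp
  moreover have "y = w \<Longrightarrow> w \<in> B" if "y \<in> monoid_closure B" for y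
    using that
  proof induction
    case zero
    then show ?case
      using W(1) w real_vector.dependent_zero by blast
  next
    case (base b)
    then show ?case
      by simp
  next
    case (add x y)
    have "x = 0 \<or> y = 0"
      using lattice_basis_irreducible[OF W L w, of x y] add B by auto
    then show ?case
      using add by auto
  qed
  ultimately show "w \<in> B"
    by blast
qed

text \<open>The basis generates the monoid and lies inside every generating set, so it is the only
  minimal one.\<close>

lemma Hilb_lattice_basis:
  assumes W: "independent W" "finite W" and L: "int_lattice d = group_closure W"
  shows "Hilb d (gen_cone W) = W"
  unfolding Hilb_def
proof (rule the_equality)
  show "minimal_generating_set W (gen_cone W \<inter> int_lattice d)"
    unfolding minimal_generating_set_def
    using lattice_basis_monoid_closure[OF W L] lattice_basis_subset_generators[OF W L] by blast
  fix B assume "minimal_generating_set B (gen_cone W \<inter> int_lattice d)"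
  then show "B = W"
    unfolding minimal_generating_set_def
    using lattice_basis_monoid_closure[OF W L] lattice_basis_subset_generators[OF W L, of B] by blast
qed

text \<open>The coordinate of \<open>w\<close> at itself is 1, and it equals \<open>k\<close> times
  an integer.\<close>

lemma lattice_basis_primitive:
  assumes W: "independent W" "finite W" and L: "int_lattice d = group_closure W" and w: "w \<in> W"
  shows "primitive_vec d w"
  unfolding primitive_vec_def
proof (intro conjI ballI allI impI)
  show "w \<in> int_lattice d"
    using w L by (auto intro: group_closure.base)
  fix u and k :: nat
  assume u: "u \<in> int_lattice d" "w = real k *\<^sub>R u"
  have u': "u \<in> span W" "representation W u w \<in> \<int>"
    using u(1) in_group_closure_iff[OF W] L by auto
  have "1 = representation W w w"
    using W w by (simp add: real_vector.representation_basis)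
  also have "\<dots> = real k * representation W u w"
    using W u' arg_cong[OF u(2), of "\<lambda>y. representation W y w"] by (simp add: real_vector.representation_scale)
  finally have eq: "real k * representation W u w = 1"
    by simp
  obtain m where m: "representation W u w = of_int m"
    using u'(2) by (auto elim: Ints_cases)
  have "real_of_int (int k * m) = 1"
    using eq m by simp
  then have "int k * m = 1"
    by linarith
  then show "k = 1"
    by (simp add: zmult_eq_1_iff)
qed

lemma simplicial_gens_lattice_basis:
  assumes "sublattice_basis d W" "cone_mult d W = 1"
  shows "simplicial_gens d W"
  using assms lattice_basis_primitive cone_mult_eq_1_iff
  unfolding simplicial_gens_def sublattice_basis_def by blast

section \<open>From cone complexes to triangulations, and from height bounds to multiples of the
  simplex\<close>

lemma unimodular_triangulation_cone_complex:
  assumes T: "cone_complex T" and V: "\<Union> (gen_cone ` T) = C"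
    and W: "\<And>W. W \<in> T \<Longrightarrow> sublattice_basis d W \<and> cone_mult d W = 1"
  shows "unimodular_triangulation d C (gen_cone ` T)"
proof -
  have gens: "simplicial_gens d W" if "W \<in> T" for W
    using simplicial_gens_lattice_basis W that by blast
  have face: "gen_cone A \<inter> gen_cone B face_of gen_cone A" if "A \<in> T" "B \<in> T" for A B
  proof -
    have "finite A" "independent A"
      using T that unfolding cone_complex_def by auto
    then show ?thesis
      unfolding cone_complex_Int[OF T that] by (intro gen_cone_face) auto
  qed
  have face': "gen_cone A \<inter> gen_cone B face_of gen_cone B" if "A \<in> T" "B \<in> T" for A B
    using face[OF that(2,1)] by (simp add: Int_commute)
  have "finite T"
    using T unfolding cone_complex_def by blast
  then show ?thesis
    unfolding unimodular_triangulation_def cone_triangulation_def simplicial_cone_def unimodular_cone_def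
    using gens W V face face' by auto
qed

text \<open>On the cone, \<open>h\<close> computes the sum of the coordinates with respect to
  \<open>V\<close>; after division by \<open>b\<close> it is at most 1, and the missing weight goes
  to the vertex 0.\<close>

lemma in_scaled_basic_simplex:
  assumes V: "independent V" "finite V" and h: "linear h" "\<And>v. v \<in> V \<Longrightarrow> h v = (1::real)"
    and y: "y \<in> gen_cone V" "h y \<le> b" and b: "b > 0"
  shows "y \<in> (\<lambda>y. b *\<^sub>R y) ` basic_simplex V"
proof -
  obtain c where c: "\<And>v. 0 \<le> c v" "y = (\<Sum>v\<in>V. c v *\<^sub>R v)"
    using y(1) unfolding gen_cone_iff by blast
  have "h y = (\<Sum>v\<in>V. c v * h v)"
    unfolding c(2) by (simp add: linear_sum[OF h(1)] linear_scale[OF h(1)])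
  also have "\<dots> = (\<Sum>v\<in>V. c v)"
    using h(2) by (intro sum.cong) auto
  finally have hy: "h y = sum c V" .
  have V0: "0 \<notin> V"
    using V(1) real_vector.dependent_zero by blast
  define u where "u v = (if v = 0 then 1 - sum c V / b else c v / b)" for v
  have u_V: "(\<Sum>v\<in>V. u v) = sum c V / b" "(\<Sum>v\<in>V. u v *\<^sub>R v) = (1 / b) *\<^sub>R y"
  proof -
    have "(\<Sum>v\<in>V. u v) = (\<Sum>v\<in>V. c v / b)"
      using V0 by (intro sum.cong) (auto simp: u_def)
    then show "(\<Sum>v\<in>V. u v) = sum c V / b"
      by (simp add: sum_divide_distrib)
    have "(\<Sum>v\<in>V. u v *\<^sub>R v) = (\<Sum>v\<in>V. (c v / b) *\<^sub>R v)"
      using V0 by (intro sum.cong) (auto simp: u_def)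
    then show "(\<Sum>v\<in>V. u v *\<^sub>R v) = (1 / b) *\<^sub>R y"
      unfolding c(2) by (simp add: scaleR_sum_right)
  qed
  have "sum c V / b \<le> 1"
    using y(2) b hy by simp
  then have "\<forall>v\<in>insert 0 V. 0 \<le> u v"
    using c(1) b by (auto simp: u_def)
  moreover have "sum u (insert 0 V) = 1"
    using V(2) V0 u_V(1) by (simp add: u_def)
  moreover have "(\<Sum>v\<in>insert 0 V. u v *\<^sub>R v) = (1 / b) *\<^sub>R y"
    using V(2) V0 u_V(2) by simp
  ultimately have "(1 / b) *\<^sub>R y \<in> basic_simplex V"
    unfolding basic_simplex_def using V(2) by (subst convex_hull_finite) auto
  moreover have "y = b *\<^sub>R ((1 / b) *\<^sub>R y)"
    using b by simp
  ultimately show ?thesis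
    by blast
qed

section \<open>Iterated subdivision\<close>

text \<open>By \<open>1 + u <= exp u\<close> the power is at most \<open>exp (-1)\<close>, and the
  same inequality at \<open>u = 1\<close> gives \<open>2 <= exp 1\<close>.\<close>

lemma power_one_minus_inverse_le_half:
  assumes "d > 0"
  shows "2 * (1 - 1 / (2 * real d)) ^ (2 * d) \<le> 1"
proof -
  have "1 - 1 / (2 * real d) \<le> exp (- (1 / (2 * real d)))"
    using exp_ge_add_one_self[of "- (1 / (2 * real d))"] by simp
  moreover have "0 \<le> 1 - 1 / (2 * real d)"
    using assms by (simp add: field_simps)
  ultimately have "(1 - 1 / (2 * real d)) ^ (2 * d) \<le> exp (- (1 / (2 * real d))) ^ (2 * d)"
    by (rule power_mono)
  also have "\<dots> = exp (real (2 * d) * - (1 / (2 * real d)))"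
    by (rule exp_of_nat_mult[symmetric])
  also have "real (2 * d) * - (1 / (2 * real d)) = -1"
    using assms by simp
  also have "exp (-1) \<le> (1 / 2 :: real)"
    using exp_ge_add_one_self[of "1 :: real"] by (simp add: exp_minus field_simps)
  finally show ?thesis
    by simp
qed

text \<open>The invariant of the iteration. For \<open>{V}\<close> both sides agree, because
  \<open>h\<close> is 1 on each of the \<open>d\<close> generators; once all multiplicities are 1,
  it bounds \<open>sum h W\<close> and thereby the height of each generator.\<close>

definition bounded_subdivision :: "nat \<Rightarrow> rvec set \<Rightarrow> (rvec \<Rightarrow> real) \<Rightarrow> rvec set set \<Rightarrow> bool" where
  "bounded_subdivision d V h T \<longleftrightarrow> cone_complex T \<and> \<Union> (gen_cone ` T) = gen_cone V \<and>
     (\<forall>W\<in>T. sublattice_basis d W \<and>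
        sum h W * real (cone_mult d W) ^ (2 * d) \<le> real d * real (cone_mult d V) ^ (2 * d))"

lemma height_nonneg:
  assumes h: "linear h" "\<And>v. v \<in> V \<Longrightarrow> h v = (1::real)" and y: "y \<in> gen_cone V"
  shows "0 \<le> h y"
proof -
  obtain c where c: "\<And>v. 0 \<le> c v" "y = (\<Sum>v\<in>V. c v *\<^sub>R v)"
    using y unfolding gen_cone_iff by blast
  show ?thesis
    unfolding c(2) using c(1) h(2) by (auto simp: linear_sum[OF h(1)] linear_scale[OF h(1)] intro!: sum_nonneg)
qed

lemma bounded_subdivision_height_nonneg:
  assumes "bounded_subdivision d V h T" "linear h" "\<And>v. v \<in> V \<Longrightarrow> h v = 1" "W \<in> T" "w \<in> W"
  shows "w \<in> gen_cone V" "0 \<le> h w"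
proof -
  have "finite W"
    using assms(1,4) unfolding bounded_subdivision_def sublattice_basis_def by blast
  then show "w \<in> gen_cone V"
    using gen_cone_base[of W w] assms(1,4,5) unfolding bounded_subdivision_def by blast
  then show "0 \<le> h w"
    using height_nonneg assms(2,3) by blast
qed

text \<open>The second conclusion supplies termination: a subdivided cone of multiplicity
  \<open>m\<close> gives way to at most \<open>d\<close> cones of smaller multiplicity, whose total
  weight is at most \<open>d (d + 1)^(m - 1)\<close>, less than \<open>(d + 1)^m\<close>.\<close>

lemma stellar_step:
  assumes T: "bounded_subdivision d V h T" and h: "linear h" "\<And>v. v \<in> V \<Longrightarrow> h v = 1"
    and W0: "W0 \<in> T" "cone_mult d W0 > 1"
  obtains T' where "bounded_subdivision d V h T'"
    "(\<Sum>W\<in>T'. Suc d ^ cone_mult d W) < (\<Sum>W\<in>T. Suc d ^ cone_mult d W)"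
proof -
  have complex: "cone_complex T" and Un: "\<Union> (gen_cone ` T) = gen_cone V"
    and basis: "\<And>W. W \<in> T \<Longrightarrow> sublattice_basis d W"
    and bound: "\<And>W. W \<in> T \<Longrightarrow>
        sum h W * real (cone_mult d W) ^ (2 * d) \<le> real d * real (cone_mult d V) ^ (2 * d)"
    using T unfolding bounded_subdivision_def by blast+
  have bD: "finite W" "independent W" "card W = d" if "W \<in> T" for W
    using basis[OF that] unfolding sublattice_basis_def by auto
  obtain p z0 x where x: "p > 0" "x \<in> int_lattice d" "real p *\<^sub>R x = (\<Sum>w\<in>W0. real (z0 w) *\<^sub>R w)"
    "\<And>w. w \<in> W0 \<Longrightarrow> 2 * d * z0 w \<le> (2 * d - 1) * p" "\<exists>w\<in>W0. z0 w > 0"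
    using exists_subdivision_vector[OF basis[OF W0(1)] W0(2)] by blast
  \<comment> \<open>Extended by 0 beyond \<open>W0\<close>, the same numerators describe
    \<open>x\<close> in every cone whose generators include its support \<open>F\<close>.\<close>
  define z where "z w = (if w \<in> W0 then z0 w else 0)" for w
  define F where "F = {w. z w > 0}"
  define a where "a w = real (z w) / real p" for w
  have FW0: "F \<subseteq> W0"
    by (auto simp: F_def z_def)
  then have finF: "finite F"
    using bD(1)[OF W0(1)] by (rule finite_subset)
  have z_le: "2 * d * z w \<le> (2 * d - 1) * p" for w
    using x(4)[of w] by (simp add: z_def)
  have d: "d > 0"
    using x(5) bD(1,3)[OF W0(1)] card_gt_0_iff by blast
  have px: "real p *\<^sub>R x = (\<Sum>w\<in>F. real (z w) *\<^sub>R w)"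
  proof -
    have "(\<Sum>w\<in>F. real (z w) *\<^sub>R w) = (\<Sum>w\<in>W0. real (z w) *\<^sub>R w)"
      using bD(1)[OF W0(1)] FW0 by (intro sum.mono_neutral_left) (auto simp: F_def)
    also have "\<dots> = (\<Sum>w\<in>W0. real (z0 w) *\<^sub>R w)"
      by (intro sum.cong) (auto simp: z_def)
    finally show ?thesis
      using x(3) by simp
  qed
  have x_eq: "x = (\<Sum>w\<in>F. a w *\<^sub>R w)"
  proof -
    have "x = (1 / real p) *\<^sub>R (real p *\<^sub>R x)"
      using x(1) by simp
    then show ?thesis
      unfolding px scaleR_sum_right by (simp add: a_def)
  qed
  interpret positive_combination F a x
    using x(1,5) x_eq by unfold_locales (auto simp: F_def a_def z_def)
  let ?T' = "stellar_subdivision x F T"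
  have a_le: "a w \<le> 1 - 1 / (2 * real d)" for w
  proof -
    have "real (2 * d * z w) \<le> real ((2 * d - 1) * p)"
      using z_le of_nat_le_iff by blast
    then have "2 * real d * real (z w) \<le> (2 * real d - 1) * real p"
      using d by (simp add: of_nat_diff)
    then show ?thesis
      using d x(1) by (simp add: a_def field_simps)
  qed
  have exch: "sublattice_basis d (insert x (W - {v}))"
    "real (cone_mult d (insert x (W - {v}))) \<le> (1 - 1 / (2 * real d)) * real (cone_mult d W)"
    if "W \<in> T" "F \<subseteq> W" "v \<in> F" for W v
  proof -
    \<comment> \<open>\<open>W\<close> may differ from \<open>W0\<close>, but the relation has the
      same \<open>p\<close> and numerators there, so the multiplicity shrinks by the factor
      \<open>a v\<close> in every subdivided cone.\<close>
    have "real p *\<^sub>R x = (\<Sum>w\<in>W. real (z w) *\<^sub>R w)"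
      unfolding px using bD(1)[OF that(1)] that(2) by (intro sum.mono_neutral_left) (auto simp: F_def)
    note ex = exchange_sublattice_basis[OF basis[OF that(1)] subsetD[OF that(2,3)] x(2) this x(1)]
    have zv: "z v > 0"
      using that(3) by (simp add: F_def)
    show "sublattice_basis d (insert x (W - {v}))"
      using ex(1)[OF zv] .
    have "real (p * cone_mult d (insert x (W - {v}))) \<le> real (z v * cone_mult d W)"
      using ex(2)[OF zv] of_nat_le_iff by blast
    then have "real (cone_mult d (insert x (W - {v}))) \<le> a v * real (cone_mult d W)"
      using x(1) by (simp add: a_def field_simps)
    also have "\<dots> \<le> (1 - 1 / (2 * real d)) * real (cone_mult d W)"
      using a_le by (intro mult_right_mono) auto
    finally show "real (cone_mult d (insert x (W - {v}))) \<le> (1 - 1 / (2 * real d)) * real (cone_mult d W)" .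
  qed
  have new_less: "cone_mult d (insert x (W - {v})) < cone_mult d W" if "W \<in> T" "F \<subseteq> W" "v \<in> F" for W v
  proof -
    have "(1 - 1 / (2 * real d)) * real (cone_mult d W) < 1 * real (cone_mult d W)"
      using d cone_mult_pos[OF basis[OF that(1)]] by (intro mult_strict_right_mono) auto
    then show ?thesis
      using exch(2)[OF that] by simp
  qed
  \<comment> \<open>The coefficients of \<open>x\<close> are at most 1 and heights are nonnegative,
    so \<open>h x\<close> does not exceed the old sum; the other generators contribute at most that
    sum again.\<close>
  have height: "sum h (insert x (W - {v})) \<le> 2 * sum h W" if "W \<in> T" "F \<subseteq> W" "v \<in> F" for W v
  proof -
    have h0: "0 \<le> h w" if "w \<in> W" for w
      using bounded_subdivision_height_nonneg(2)[OF T h \<open>W \<in> T\<close> that] by blast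
    have "h x = (\<Sum>w\<in>W. a w * h w)"
      by (subst x_eq_sum[OF bD(1)[OF that(1)] that(2)]) (simp add: linear_sum[OF h(1)] linear_scale[OF h(1)])
    also have "\<dots> \<le> (\<Sum>w\<in>W. 1 * h w)"
    proof (intro sum_mono mult_right_mono)
      fix w assume "w \<in> W"
      show "a w \<le> 1"
        using a_le[of w] d by (smt (verit) divide_pos_pos of_nat_0_less_iff)
      show "0 \<le> h w"
        using h0 \<open>w \<in> W\<close> .
    qed
    finally have hx: "h x \<le> sum h W"
      by simp
    have "sum h (W - {v}) \<le> sum h W"
      using h0 bD(1)[OF that(1)] by (intro sum_mono2) auto
    moreover have "sum h (insert x (W - {v})) = h x + sum h (W - {v})"
      using bD[OF that(1)] exchange(1)[OF bD(2,1)[OF that(1)] that(2,3)] by (intro sum.insert) auto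
    ultimately show ?thesis
      using hx by linarith
  qed
  have bound': "sublattice_basis d A \<and>
      sum h A * real (cone_mult d A) ^ (2 * d) \<le> real d * real (cone_mult d V) ^ (2 * d)"
    if "A \<in> ?T'" for A
    using that
  proof (cases rule: stellar_subdivision_cases)
    case old
    then show ?thesis
      using basis bound by blast
  next
    case (new W v)
    let ?q = "1 - 1 / (2 * real d)"
    have h0: "0 \<le> sum h W"
      using bounded_subdivision_height_nonneg(2)[OF T h new(1)] by (intro sum_nonneg) blast
    have "real (cone_mult d A) ^ (2 * d) \<le> (?q * real (cone_mult d W)) ^ (2 * d)"
      unfolding new(4) using exch(2)[OF new(1-3)]
      by (intro power_mono) auto
    then have "sum h A * real (cone_mult d A) ^ (2 * d) \<le> (2 * sum h W) * (?q * real (cone_mult d W)) ^ (2 * d)"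
      using height[OF new(1-3)] h0 unfolding new(4) by (intro mult_mono) auto
    \<comment> \<open>The doubling of the height sum is paired with the shrinking of the
      multiplicity; the exponent \<open>2 d\<close> is chosen so that the combined factor is at most
      1.\<close>
    also have "\<dots> = (2 * ?q ^ (2 * d)) * (sum h W * real (cone_mult d W) ^ (2 * d))"
      by (simp add: power_mult_distrib)
    also have "\<dots> \<le> 1 * (sum h W * real (cone_mult d W) ^ (2 * d))"
      using power_one_minus_inverse_le_half[OF d] h0 by (intro mult_right_mono) auto
    also have "\<dots> \<le> real d * real (cone_mult d V) ^ (2 * d)"
      using bound[OF new(1)] by simp
    finally show ?thesis
      using exch(1)[OF new(1-3)] new(4) by blast
  qed
  have "bounded_subdivision d V h ?T'"
    unfolding bounded_subdivision_def
    using cone_complex_stellar_subdivision[OF complex finF] Union_stellar_subdivision[OF complex] Un bound'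
    by simp
  moreover have "(\<Sum>W\<in>?T'. Suc d ^ cone_mult d W) < (\<Sum>W\<in>T. Suc d ^ cone_mult d W)"
  proof -
    let ?m = "\<lambda>W. Suc d ^ cone_mult d W"
    let ?f = "\<lambda>(W, v). insert x (W - {v})"
    define S where "S = {W \<in> T. F \<subseteq> W}"
    have finT: "finite T"
      using complex unfolding cone_complex_def by blast
    have S: "finite S" "S \<noteq> {}" "S \<subseteq> T"
      using finT W0(1) FW0 by (auto simp: S_def)
    have T'_eq: "?T' = (T - S) \<union> ?f ` (S \<times> F)"
      unfolding stellar_subdivision_def S_def by blast
    \<comment> \<open>Only inequalities are claimed, so neither disjointness nor injectivity has to
      be shown for the new family.\<close>
    have "sum ?m ?T' \<le> sum ?m (T - S) + sum ?m (?f ` (S \<times> F))"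
      unfolding T'_eq using finT S(1) finF by (subst sum_Un_nat) auto
    also have "sum ?m (?f ` (S \<times> F)) \<le> sum (?m \<circ> ?f) (S \<times> F)"
      using S(1) finF by (intro sum_image_le) auto
    also have "\<dots> = (\<Sum>W\<in>S. \<Sum>v\<in>F. ?m (insert x (W - {v})))"
      by (simp add: sum.cartesian_product split_def)
    also have "\<dots> < (\<Sum>W\<in>S. ?m W)"
    proof (rule sum_strict_mono[OF S(1,2)])
      fix W assume "W \<in> S"
      then have W: "W \<in> T" "F \<subseteq> W"
        by (auto simp: S_def)
      obtain k where k: "cone_mult d W = Suc k"
        using cone_mult_pos[OF basis[OF W(1)]] gr0_conv_Suc by blast
      have "(\<Sum>v\<in>F. ?m (insert x (W - {v}))) \<le> (\<Sum>v\<in>F. Suc d ^ k)"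
      proof (intro sum_mono power_increasing)
        fix v assume "v \<in> F"
        then show "cone_mult d (insert x (W - {v})) \<le> k"
          using new_less[OF W] k by fastforce
      qed simp
      also have "\<dots> = card F * Suc d ^ k"
        by simp
      also have "\<dots> \<le> d * Suc d ^ k"
        using card_mono[OF bD(1)[OF W(1)] W(2)] bD(3)[OF W(1)] by (intro mult_right_mono) auto
      also have "\<dots> < ?m W"
        unfolding k by simp
      finally show "(\<Sum>v\<in>F. ?m (insert x (W - {v}))) < ?m W" .
    qed
    also have "sum ?m (T - S) + sum ?m S = sum ?m T"
      using sum.subset_diff[OF S(3) finT, of ?m] by simp
    finally show ?thesis
      by simp
  qed
  ultimately show ?thesis
    using that by blast
qed

text \<open>Well-founded induction on the weight from \<open>stellar_step\<close>; when no
  multiplicity exceeds 1, positivity makes all of them 1.\<close>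

lemma exists_unimodular_subdivision:
  assumes "bounded_subdivision d V h T" and h: "linear h" "\<And>v. v \<in> V \<Longrightarrow> h v = 1"
  shows "\<exists>T'. bounded_subdivision d V h T' \<and> (\<forall>W\<in>T'. cone_mult d W = 1)"
  using assms(1)
proof (induction "\<Sum>W\<in>T. Suc d ^ cone_mult d W" arbitrary: T rule: less_induct)
  case less
  show ?case
  proof (cases "\<exists>W\<in>T. cone_mult d W > 1")
    case True
    then show ?thesis
      using stellar_step[OF less.prems h] less.hyps by metis
  next
    case False
    have "cone_mult d W = 1" if "W \<in> T" for W
    proof -
      have "sublattice_basis d W"
        using less.prems that unfolding bounded_subdivision_def by blast
      then have "cone_mult d W > 0"
        by (rule cone_mult_pos)
      moreover have "\<not> cone_mult d W > 1"
        using False that by blast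
      ultimately show ?thesis
        by linarith
    qed
    then show ?thesis
      using less.prems by blast
  qed
qed

section \<open>Assembling the bound with exponent \<open>3 d\<close>\<close>

theorem corollary5p4:
  shows "\<exists>f :: nat \<Rightarrow> real. f \<in> O(\<lambda>d. real d) \<and>
    (\<forall>d\<ge>2. \<forall>V. simplicial_gens d V \<longrightarrow> cone_mult d V > 1 \<longrightarrow>
      (\<exists>T. unimodular_triangulation d (gen_cone V) T \<and>
        (\<forall>D\<in>T. Hilb d D \<subseteq>
           (\<lambda>y. (real (cone_mult d V) powr f d) *\<^sub>R y) ` basic_simplex V)))"
proof (intro exI[of _ "\<lambda>d. 3 * real d"] conjI allI impI)
  show "(\<lambda>d. 3 * real d) \<in> O(\<lambda>d. real d)"
    by simp
  fix d V assume d: "2 \<le> d" and V: "simplicial_gens d V" and mult: "cone_mult d V > 1"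
  have VD: "finite V" "card V = d" "independent V" "V \<subseteq> int_lattice d"
    using V unfolding simplicial_gens_def primitive_vec_def by auto
  \<comment> \<open>An infinite set of cosets would have cardinality 0, so a multiplicity above 1
    yields finite index.\<close>
  have "finite (cosets (int_lattice d) (group_closure V))"
    using mult unfolding cone_mult_def by (intro card_ge_0_finite) simp
  then have basis: "sublattice_basis d V"
    unfolding sublattice_basis_def using VD by blast
  obtain h :: "rvec \<Rightarrow> real" where h: "linear h" "\<And>v. v \<in> V \<Longrightarrow> h v = 1"
    using linear_independent_extend[OF VD(3), of "\<lambda>_. 1"] by blast
  have "bounded_subdivision d V h {V}"
    unfolding bounded_subdivision_def cone_complex_def using VD basis h(2) by simp
  then obtain T where T: "bounded_subdivision d V h T" "\<And>W. W \<in> T \<Longrightarrow> cone_mult d W = 1"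
    using exists_unimodular_subdivision[OF _ h] by blast
  let ?b = "real (cone_mult d V) powr (3 * real d)"
  have b: "real d * real (cone_mult d V) ^ (2 * d) \<le> ?b"
  proof -
    \<comment> \<open>Since the multiplicity is at least 2, its \<open>d\<close>-th power absorbs
      the factor \<open>d\<close>; this raises the exponent from \<open>2 d\<close> to
      \<open>3 d\<close>.\<close>
    have "real d \<le> 2 ^ d"
      using of_nat_le_iff[of d "2 ^ d"] less_exp[of d] by simp
    also have "\<dots> \<le> real (cone_mult d V) ^ d"
      using mult by (intro power_mono) auto
    finally have "real d * real (cone_mult d V) ^ (2 * d) \<le> real (cone_mult d V) ^ d * real (cone_mult d V) ^ (2 * d)"
      by (rule mult_right_mono) simp
    also have "\<dots> = real (cone_mult d V) ^ (3 * d)"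
      by (simp add: power_add[symmetric])
    also have "\<dots> = ?b"
      using mult powr_realpow[of "real (cone_mult d V)" "3 * d"] by simp
    finally show ?thesis .
  qed
  have basisT: "sublattice_basis d W" if "W \<in> T" for W
    using T(1) that unfolding bounded_subdivision_def by blast
  have short: "Hilb d (gen_cone W) \<subseteq> (\<lambda>y. ?b *\<^sub>R y) ` basic_simplex V" if W: "W \<in> T" for W
  proof
    have WD: "finite W" "independent W"
      using basisT[OF W] unfolding sublattice_basis_def by auto
    have "int_lattice d = group_closure W"
      using cone_mult_eq_1_iff[OF basisT[OF W]] T(2)[OF W] by blast
    then have "Hilb d (gen_cone W) = W"
      using Hilb_lattice_basis WD by blast
    moreover fix w assume "w \<in> Hilb d (gen_cone W)"
    ultimately have w: "w \<in> W"
      by simp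
    have "h w \<le> sum h W"
      using bounded_subdivision_height_nonneg(2)[OF T(1) h W] WD(1) w by (intro member_le_sum) auto
    also have "\<dots> \<le> real d * real (cone_mult d V) ^ (2 * d)"
      using T W unfolding bounded_subdivision_def by fastforce
    finally have "h w \<le> ?b"
      using b by linarith
    moreover have "?b > 0"
      using mult by simp
    ultimately show "w \<in> (\<lambda>y. ?b *\<^sub>R y) ` basic_simplex V"
      using in_scaled_basic_simplex[OF VD(3,1) h bounded_subdivision_height_nonneg(1)[OF T(1) h W w]] by blast
  qed
  have "unimodular_triangulation d (gen_cone V) (gen_cone ` T)"
    using T basisT unfolding bounded_subdivision_def by (intro unimodular_triangulation_cone_complex) auto
  then show "\<exists>T. unimodular_triangulation d (gen_cone V) T \<and>
      (\<forall>D\<in>T. Hilb d D \<subseteq> (\<lambda>y. ?b *\<^sub>R y) ` basic_simplex V)"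
    using short by blast
qed

end
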